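(* The following is a complete list of the one-dimensional real Lie subalgebras of $\mathfrak{su}(2,1)$ up to conjugation in $\mathrm{SU}(2,1)$: (1) $\mathfrak{v}_{1,1}=\langle -A_1-2A_2-A_4+\sqrt2A_6+\sqrt2A_8\rangle$; (2) $\mathfrak{v}_{1,2}=\langle A_3+A_4+A_7-A_8\rangle$; (3) $\mathfrak{v}_{1,3}=\langle 3A_1+6A_2-5A_4-\sqrt2A_6-\sqrt2A_8\rangle$; (4) $\mathfrak{v}_{1,4}=\langle A_1+2A_2+7A_4-\sqrt2A_6+\sqrt2A_8\rangle$; (5) $\mathfrak{v}_{1,5}^\lambda=\langle A_1+\lambda A_2\rangle$, $\lambda\in\mathbb{R}$, where $\mathfrak{v}_{1,5}^\lambda\sim\mathfrak{v}_{1,5}^\eta$ iff $\eta=\lambda$ or $\eta=\frac{\lambda}{\lambda-1}$ (the latter only when $\lambda\neq1$) (alternatively, one takes $\mathfrak{v}_{1,5}^\lambda$ with $\lambda\in[0,2]$, these being pairwise inequivalent and representing all members of the family); (6) $\mathfrak{v}_{1,6}=\langle A_5-A_7\rangle$; (7) $\mathfrak{v}_{1,7}^\lambda=\langle A_1-A_2+\lambda A_5\rangle$, $\lambda\in\mathbb{R}\setminus\{0\}$, where $\mathfrak{v}_{1,7}^\lambda\sim\mathfrak{v}_{1,7}^\eta$ iff $\eta=\pm\lambda$ (alternatively, one takes $\mathfrak{v}_{1,7}^\lambda$ with $\lambda\in(0,\infty)$). That is, every one-dimensional real subalgebra of $\mathfrak{su}(2,1)$ is conjugate under $\mathrm{SU}(2,1)$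 to a subalgebra in this list, and subalgebras in the list are pairwise non-conjugate under $\mathrm{SU}(2,1)$ except for the conjugacies within the families (5) and (7) indicated above.
   Context: Let $N=\mathrm{diag}(1,1,-1)$. $\mathfrak{su}(2,1)$ is the real Lie algebra of traceless complex $3\times3$ matrices $x$ with $-N\bar x^{t}N^{-1}=x$, and $\mathrm{SU}(2,1)$ is the group of $g\in\mathrm{SL}_3(\mathbb{C})$ with $N(\bar g^{t})^{-1}N^{-1}=g$. $\mathrm{SU}(2,1)$ acts on subalgebras by $g\cdot\mathfrak{v}=g\mathfrak{v}g^{-1}$; $\mathfrak{u}\sim\mathfrak{v}$ means that $\mathfrak{u}$ and $\mathfrak{v}$ lie in the same orbit. With $E_{ij}$ the matrix units, the real basis of $\mathfrak{su}(2,1)$ used is $A_1=i(E_{11}-E_{22})$, $A_2=i(E_{22}-E_{33})$, $A_3=E_{12}-E_{21}$, $A_4=i(E_{12}+E_{21})$, $A_5=E_{13}+E_{31}$, $A_6=i(E_{13}-E_{31})$, $A_7=E_{23}+E_{32}$, $A_8=i(E_{23}-E_{32})$. $\langle\cdots\rangle$ denotes the real linear span. *)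

theory Defs
  imports "HOL-Analysis.Analysis"
begin

type_synonym cmat3 = "complex^3^3"

text \<open>Rows and columns are indexed by the numeral type \<^typ>\<open>3\<close>, whose elements are 1, 2 and 3 (= 0).\<close>

definition ctranspose :: "cmat3 \<Rightarrow> cmat3" where
  "ctranspose x = (\<chi> i j. cnj (x $ j $ i))"

definition N21 :: cmat3 where
  "N21 = (\<chi> i j. if i = j then (if i = 3 then - 1 else 1) else 0)"

definition su21 :: "cmat3 set" where
  "su21 = {x. trace x = 0 \<and> - (N21 ** ctranspose x ** matrix_inv N21) = x}"

definition SU21 :: "cmat3 set" where
  "SU21 = {g. det g = 1 \<and> N21 ** matrix_inv (ctranspose g) ** matrix_inv N21 = g}"

definition lie_bracket :: "cmat3 \<Rightarrow> cmat3 \<Rightarrow> cmat3" where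
  "lie_bracket x y = x ** y - y ** x"

text \<open>\<^const>\<open>subspace\<close>, \<^const>\<open>dim\<close> and \<^const>\<open>span\<close> refer to the real vector space
  structure of the matrices.\<close>

definition lie_subalgebra_su21 :: "cmat3 set \<Rightarrow> bool" where
  "lie_subalgebra_su21 \<vv> \<longleftrightarrow>
     \<vv> \<subseteq> su21 \<and> subspace \<vv> \<and> (\<forall>x\<in>\<vv>. \<forall>y\<in>\<vv>. lie_bracket x y \<in> \<vv>)"

definition SU21_act :: "cmat3 \<Rightarrow> cmat3 set \<Rightarrow> cmat3 set" where
  "SU21_act g \<vv> = (\<lambda>x. g ** x ** matrix_inv g) ` \<vv>"

definition SU21_conj :: "cmat3 set \<Rightarrow> cmat3 set \<Rightarrow> bool"  (infix "\<sim>\<^sub>S\<^sub>U" 50) where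
  "\<uu> \<sim>\<^sub>S\<^sub>U \<vv> \<longleftrightarrow> (\<exists>g\<in>SU21. SU21_act g \<uu> = \<vv>)"

text \<open>\<open>cE c i j\<close> is the scalar multiple \<open>c E\<^sub>i\<^sub>j\<close> of a matrix unit.\<close>

definition cE :: "complex \<Rightarrow> 3 \<Rightarrow> 3 \<Rightarrow> cmat3" where
  "cE c i j = (\<chi> k l. if k = i \<and> l = j then c else 0)"

definition A1 :: cmat3 where "A1 = cE \<i> 1 1 - cE \<i> 2 2"
definition A2 :: cmat3 where "A2 = cE \<i> 2 2 - cE \<i> 3 3"
definition A3 :: cmat3 where "A3 = cE 1 1 2 - cE 1 2 1"
definition A4 :: cmat3 where "A4 = cE \<i> 1 2 + cE \<i> 2 1"
definition A5 :: cmat3 where "A5 = cE 1 1 3 + cE 1 3 1"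
definition A6 :: cmat3 where "A6 = cE \<i> 1 3 - cE \<i> 3 1"
definition A7 :: cmat3 where "A7 = cE 1 2 3 + cE 1 3 2"
definition A8 :: cmat3 where "A8 = cE \<i> 2 3 - cE \<i> 3 2"

text \<open>The entries of the list are named by labels, so that entries can be told apart
  independently of whether the subalgebras they denote coincide.\<close>

datatype label = V11 | V12 | V13 | V14 | V15 real | V16 | V17 real

fun subalg :: "label \<Rightarrow> cmat3 set" where
  "subalg V11 = span {- A1 - 2 *\<^sub>R A2 - A4 + sqrt 2 *\<^sub>R A6 + sqrt 2 *\<^sub>R A8}"
| "subalg V12 = span {A3 + A4 + A7 - A8}"
| "subalg V13 = span {3 *\<^sub>R A1 + 6 *\<^sub>R A2 - 5 *\<^sub>R A4 - sqrt 2 *\<^sub>R A6 - sqrt 2 *\<^sub>R A8}"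
| "subalg V14 = span {A1 + 2 *\<^sub>R A2 + 7 *\<^sub>R A4 - sqrt 2 *\<^sub>R A6 + sqrt 2 *\<^sub>R A8}"
| "subalg (V15 \<mu>) = span {A1 + \<mu> *\<^sub>R A2}"
| "subalg V16 = span {A5 - A7}"
| "subalg (V17 \<mu>) = span {A1 - A2 + \<mu> *\<^sub>R A5}"

definition labels :: "label set" where
  "labels = {V11, V12, V13, V14, V16} \<union> range V15 \<union> V17 ` {\<mu>. \<mu> \<noteq> 0}"

end

theory Submission
  imports Defs "HOL-Computational_Algebra.Fundamental_Theorem_Algebra"
begin

text \<open>
  Two elements of \<open>\<ss>\<uu>(2,1)\<close> are conjugate as soon as they have the same matrix with respect to bases
  with the same Gram matrix; the determinant of the resulting isometry is corrected by a scalar cube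
  root of unit modulus. For completeness of the list, a nonzero \<open>x\<close> always has an eigenvector \<open>v\<close> that is
  negative or null: if \<open>v\<close> and \<open>w\<close> are positive eigenvectors with different eigenvalues, then their
  Hermitian cross product is a negative one, and if there is only one eigenvalue, then \<open>x\<close> is nilpotent
  and the last nonzero power of \<open>x\<close> has null vectors in its image. A negative eigenvector makes \<open>x\<close>
  diagonalisable in a pseudo-orthonormal basis (\<open>V15\<close>). A null eigenvector is the first vector of a Witt
  basis, in which \<open>x\<close> is upper triangular, and unipotent and diagonal changes of the Witt basis lead to
  the other normal forms.

  The families are told apart by having a negative eigenvector (only \<open>V15\<close>), by \<open>x\<^sup>2\<close>, \<open>tr x\<^sup>2\<close>, \<open>det x\<close>
  and the discriminant of the characteristic polynomial. Only \<open>V13\<close> and \<open>V14\<close> agree in all of these; there the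
  sign of the Hermitian form \<open>w \<mapsto> \<langle>(x + 4i)w, w\<rangle> / i\<close> decides.
\<close>

section \<open>Matrices with three rows and frames\<close>

text \<open>Writing out all nine entries turns matrix identities into scalar ones within reach of
  \<open>simp\<close> and \<open>algebra\<close>.\<close>

definition mk3 :: "'a \<Rightarrow> 'a \<Rightarrow> 'a \<Rightarrow> 'a \<Rightarrow> 'a \<Rightarrow> 'a \<Rightarrow> 'a \<Rightarrow> 'a \<Rightarrow> 'a \<Rightarrow> 'a::zero^3^3" where
  "mk3 a b c d e f g h k = vector [vector [a, b, c], vector [d, e, f], vector [g, h, k]]"

lemma mk3_nth [simp]:
  "mk3 a b c d e f g h k $ 1 = vector [a, b, c]"
  "mk3 a b c d e f g h k $ 2 = vector [d, e, f]"
  "mk3 a b c d e f g h k $ 3 = vector [g, h, k]"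
  by (simp_all add: mk3_def)

lemma mk3_cases: obtains a b c d e f g h k where "A = mk3 a b c d e f g h k"
proof
  show "A = mk3 (A$1$1) (A$1$2) (A$1$3) (A$2$1) (A$2$2) (A$2$3) (A$3$1) (A$3$2) (A$3$3)"
    by (simp add: vec_eq_iff forall_3)
qed

lemma mk3_eq_iff:
  "mk3 a b c d e f g h k = mk3 a' b' c' d' e' f' g' h' k' \<longleftrightarrow>
   a = a' \<and> b = b' \<and> c = c' \<and> d = d' \<and> e = e' \<and> f = f' \<and> g = g' \<and> h = h' \<and> k = k'"
  by (auto simp: vec_eq_iff forall_3)

lemma vec3_cases: obtains a b c where "v = (vector [a, b, c] :: 'a::zero^3)"
proof
  show "v = vector [v$1, v$2, v$3]"
    by (simp add: vec_eq_iff forall_3)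
qed

lemma vec3_eq_iff: "(vector [a, b, c] :: 'a::zero^3) = vector [a', b', c'] \<longleftrightarrow> a = a' \<and> b = b' \<and> c = c'"
  by (auto simp: vec_eq_iff forall_3)

lemma vec3_0: "(0 :: 'a::zero^3) = vector [0, 0, 0]"
  by (simp add: vec_eq_iff forall_3)

lemma vec3_smult: "t *s (vector [a, b, c] :: 'a::semiring_1^3) = vector [t * a, t * b, t * c]"
  by (simp add: vec_eq_iff forall_3)

lemma mk3_mult:
  "mk3 a b c d e f g h k ** mk3 a' b' c' d' e' f' g' h' k' =
   mk3 (a*a'+b*d'+c*g') (a*b'+b*e'+c*h') (a*c'+b*f'+c*k')
       (d*a'+e*d'+f*g') (d*b'+e*e'+f*h') (d*c'+e*f'+f*k')
       (g*a'+h*d'+k*g') (g*b'+h*e'+k*h') (g*c'+h*f'+(k::'a::comm_ring_1)*k')"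
  by (simp add: vec_eq_iff forall_3 matrix_matrix_mult_def sum_3)

lemma mk3_mult_vec:
  "mk3 a b c d e f g h k *v vector [x, y, z] =
   vector [a*x+b*y+c*z, d*x+e*y+f*z, g*x+h*y+(k::'a::comm_ring_1)*z]"
  by (simp add: vec_eq_iff forall_3 matrix_vector_mult_def sum_3)

lemma mk3_add: "mk3 a b c d e f g h k + mk3 a' b' c' d' e' f' g' h' (k'::'a::ab_group_add) =
   mk3 (a+a') (b+b') (c+c') (d+d') (e+e') (f+f') (g+g') (h+h') (k+k')"
  by (simp add: vec_eq_iff forall_3)

lemma mk3_diff: "mk3 a b c d e f g h k - mk3 a' b' c' d' e' f' g' h' (k'::'a::ab_group_add) =
   mk3 (a-a') (b-b') (c-c') (d-d') (e-e') (f-f') (g-g') (h-h') (k-k')"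
  by (simp add: vec_eq_iff forall_3)

lemma mk3_uminus: "- mk3 a b c d e f g h (k::'a::ab_group_add) =
   mk3 (-a) (-b) (-c) (-d) (-e) (-f) (-g) (-h) (-k)"
  by (simp add: vec_eq_iff forall_3)

lemma mk3_scaleR: "r *\<^sub>R mk3 a b c d e f g h (k::complex) =
   mk3 (of_real r*a) (of_real r*b) (of_real r*c) (of_real r*d) (of_real r*e)
     (of_real r*f) (of_real r*g) (of_real r*h) (of_real r*k)"
  by (simp add: vec_eq_iff forall_3) (simp add: scaleR_conv_of_real)

lemma mk3_det: "det (mk3 a b c d e f g h (k::'a::comm_ring_1)) =
   a*e*k + b*f*g + c*d*h - a*f*h - b*d*k - c*e*g"
  by (simp add: det_3)

lemma mk3_trace: "trace (mk3 a b c d e f g h (k::'a::comm_ring_1)) = a + e + k"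
  by (simp add: trace_def sum_3)

lemma mk3_ctranspose: "ctranspose (mk3 a b c d e f g h k) =
   mk3 (cnj a) (cnj d) (cnj g) (cnj b) (cnj e) (cnj h) (cnj c) (cnj f) (cnj k)"
  by (simp add: vec_eq_iff forall_3 ctranspose_def)

lemma mk3_mat: "mat t = mk3 t 0 0 0 t 0 0 0 t"
  by (simp add: vec_eq_iff forall_3 mat_def)

lemma mk3_0: "(0 :: 'a::zero^3^3) = mk3 0 0 0 0 0 0 0 0 0"
  by (simp add: vec_eq_iff forall_3)

lemma N21_eq: "N21 = mk3 1 0 0 0 1 0 0 0 (-1)"
  by (simp add: vec_eq_iff forall_3 N21_def)

lemmas mk3_simps = mk3_mult mk3_mult_vec mk3_add mk3_diff mk3_uminus mk3_scaleR mk3_det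
  mk3_trace mk3_ctranspose mk3_mat N21_eq mk3_eq_iff vec3_eq_iff vec3_smult

lemma A_eqs:
  "A1 = mk3 \<i> 0 0 0 (-\<i>) 0 0 0 0"
  "A2 = mk3 0 0 0 0 \<i> 0 0 0 (-\<i>)"
  "A3 = mk3 0 1 0 (-1) 0 0 0 0 0"
  "A4 = mk3 0 \<i> 0 \<i> 0 0 0 0 0"
  "A5 = mk3 0 0 1 0 0 0 1 0 0"
  "A6 = mk3 0 0 \<i> 0 0 0 (-\<i>) 0 0"
  "A7 = mk3 0 0 0 0 0 1 0 1 0"
  "A8 = mk3 0 0 0 0 0 \<i> 0 (-\<i>) 0"
  by (simp_all add: vec_eq_iff forall_3 cE_def A1_def A2_def A3_def A4_def A5_def A6_def A7_def A8_def)

section \<open>Matrix inverses, and the defining equations in terms of the Hermitian form\<close>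

lemma matrix_inv_mult:
  fixes A :: "'a::field^'n^'n"
  assumes "det A \<noteq> 0"
  shows "A ** matrix_inv A = mat 1" "matrix_inv A ** A = mat 1"
proof -
  have "\<exists>B. A ** B = mat 1 \<and> B ** A = mat 1"
    using assms by (simp add: invertible_det_nz [symmetric] invertible_def)
  then have "A ** matrix_inv A = mat 1 \<and> matrix_inv A ** A = mat 1"
    unfolding matrix_inv_def by (rule someI_ex)
  then show "A ** matrix_inv A = mat 1" "matrix_inv A ** A = mat 1" by auto
qed

lemma matrix_inv_eqI:
  fixes A :: "'a::field^'n^'n"
  assumes "A ** B = mat 1" shows "matrix_inv A = B"
proof -
  have "det A * det B = 1" by (metis assms det_I det_mul)
  then have "matrix_inv A ** A = mat 1" by (intro matrix_inv_mult) auto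
  then have "matrix_inv A ** A ** B = B" by simp
  then show ?thesis by (simp add: matrix_mul_assoc [symmetric] assms)
qed

lemma matrix_inv_N21: "matrix_inv N21 = N21"
  by (rule matrix_inv_eqI) (simp add: mk3_simps)

lemma N21_mult_N21: "N21 ** N21 = mat 1"
  by (simp add: mk3_simps)

lemma ctranspose_mult: "ctranspose (A ** B) = ctranspose B ** ctranspose A"
  by (simp add: ctranspose_def matrix_matrix_mult_def vec_eq_iff mult.commute)

lemma matrix_add_rdistrib: "(A + B) ** C = A ** C + B ** (C :: 'a::semiring_1^'n^'m)"
  by (simp add: vec_eq_iff matrix_matrix_mult_def sum.distrib distrib_right)

lemma det_ctranspose: "det (ctranspose A) = cnj (det A)"
  by (simp add: det_3 ctranspose_def)

text \<open>Since \<open>N21\<close> is its own inverse, the defining equation says that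
  \<open>x\<close> is skew for the form with Gram matrix \<open>N21\<close>.\<close>

lemma su21_iff: "x \<in> su21 \<longleftrightarrow> trace x = 0 \<and> ctranspose x ** N21 + N21 ** x = 0"
proof -
  obtain a b c d e f g h k where x: "x = mk3 a b c d e f g h k" by (rule mk3_cases)
  show ?thesis
    unfolding su21_def mem_Collect_eq matrix_inv_N21 
    by (auto simp: x mk3_simps mk3_0 eq_neg_iff_add_eq_0 neg_eq_iff_add_eq_0 algebra_simps)
qed

lemma SU21_iff: "g \<in> SU21 \<longleftrightarrow> det g = 1 \<and> ctranspose g ** N21 ** g = N21"
proof (cases "det g = 1")
  case True
  then have "det (ctranspose g) \<noteq> 0" by (simp add: det_ctranspose)
  note i = matrix_inv_mult [OF this]
  have "N21 ** matrix_inv (ctranspose g) ** N21 = g \<longleftrightarrow> ctranspose g ** N21 ** g = N21"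
  proof
    assume "N21 ** matrix_inv (ctranspose g) ** N21 = g"
    then have "ctranspose g ** N21 ** g = ctranspose g ** N21 ** (N21 ** matrix_inv (ctranspose g) ** N21)"
      by simp
    also have "\<dots> = ctranspose g ** (N21 ** N21) ** matrix_inv (ctranspose g) ** N21"
      by (simp add: matrix_mul_assoc)
    finally show "ctranspose g ** N21 ** g = N21" by (simp add: N21_mult_N21 i)
  next
    assume "ctranspose g ** N21 ** g = N21"
    then have "N21 ** matrix_inv (ctranspose g) ** N21 = N21 ** matrix_inv (ctranspose g) ** (ctranspose g ** N21 ** g)"
      by simp
    also have "\<dots> = N21 ** (matrix_inv (ctranspose g) ** ctranspose g) ** N21 ** g"
      by (simp add: matrix_mul_assoc)
    finally show "N21 ** matrix_inv (ctranspose g) ** N21 = g" by (simp add: N21_mult_N21 i)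
  qed
  then show ?thesis by (simp add: SU21_def matrix_inv_N21 True)
qed (simp add: SU21_def)

section \<open>Bases adapted to the form, and conjugacy of lines\<close>

text \<open>\<open>frame x G M\<close>: in some basis, the columns of \<open>P\<close>, the Hermitian form has Gram matrix \<open>G\<close>
  and \<open>x\<close> has matrix \<open>M\<close>.\<close>

definition frame :: "cmat3 \<Rightarrow> cmat3 \<Rightarrow> cmat3 \<Rightarrow> bool" where
  "frame x G M \<longleftrightarrow> (\<exists>P. det P \<noteq> 0 \<and> ctranspose P ** N21 ** P = G \<and> x ** P = P ** M)"

lemma frame_change:
  assumes "frame x G M" "det S \<noteq> 0" "ctranspose S ** G ** S = G'" "M ** S = S ** M'"
  shows "frame x G' M'"
proof -
  obtain P where P: "det P \<noteq> 0" "ctranspose P ** N21 ** P = G" "x ** P = P ** M"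
    using assms(1) by (auto simp: frame_def)
  have "ctranspose (P ** S) ** N21 ** (P ** S) = ctranspose S ** (ctranspose P ** N21 ** P) ** S"
    by (simp add: ctranspose_mult matrix_mul_assoc)
  moreover have "x ** (P ** S) = P ** S ** M'"
    by (simp add: matrix_mul_assoc P(3)) (simp add: matrix_mul_assoc [symmetric] assms(4))
  moreover have "det (P ** S) \<noteq> 0" by (simp add: det_mul P assms(2))
  ultimately show ?thesis unfolding frame_def using P assms(3) by metis
qed

text \<open>Skewness of \<open>x\<close> pulls back along the basis \<open>P\<close> to skewness for
  \<open>G\<close>, and \<open>M\<close> is similar to \<open>x\<close>.\<close>

lemma frame_skew:
  assumes "frame x G M" "x \<in> su21"
  shows "ctranspose M ** G + G ** M = 0" "trace M = 0"
proof -
  obtain P where P: "det P \<noteq> 0" "ctranspose P ** N21 ** P = G" "x ** P = P ** M"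
    using assms(1) by (auto simp: frame_def)
  have "ctranspose M ** G + G ** M = ctranspose (P ** M) ** N21 ** P + ctranspose P ** N21 ** (P ** M)"
    by (simp add: ctranspose_mult matrix_mul_assoc P(2) [symmetric])
  also have "\<dots> = ctranspose P ** (ctranspose x ** N21 + N21 ** x) ** P"
    by (simp add: P(3) [symmetric] ctranspose_mult matrix_mul_assoc matrix_add_ldistrib matrix_add_rdistrib)
  also have "\<dots> = 0" using assms(2) by (simp add: su21_iff)
  finally show "ctranspose M ** G + G ** M = 0" .
  have "trace M = trace (matrix_inv P ** (P ** M))"
    by (simp add: matrix_mul_assoc matrix_inv_mult P)
  also have "\<dots> = trace (x ** P ** matrix_inv P)" by (metis P(3) trace_mul_sym)
  also have "\<dots> = trace x" by (simp add: matrix_mul_assoc [symmetric] matrix_inv_mult P(1))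
  finally show "trace M = 0" using assms(2) by (simp add: su21_iff)
qed

lemma exists_unit_cube_root:
  assumes "cmod d = 1" obtains c where "c ^ 3 = d" "cmod c = 1"
proof
  have "d \<noteq> 0" using assms by auto
  then have "cis (Arg d) = d" using assms by (simp add: cis_Arg sgn_div_norm)
  then show "cis (Arg d / 3) ^ 3 = d"
    by (simp add: Complex.DeMoivre)
qed simp

lemma span_singleton_scaleR:
  fixes x :: "'a::real_vector"
  assumes "c \<noteq> 0" shows "span {c *\<^sub>R x} = span {x}"
proof -
  have "(1 / c) *\<^sub>R (c *\<^sub>R x) \<in> span {c *\<^sub>R x}" by (intro span_scale span_base) simp
  then have "x \<in> span {c *\<^sub>R x}" using assms by simp
  moreover have "c *\<^sub>R x \<in> span {x}" by (intro span_scale span_base) simp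
  ultimately show ?thesis by (simp add: span_eq)
qed

lemma SU21_act_span: "SU21_act g (span {x}) = span {g ** x ** matrix_inv g}"
proof -
  have "g ** (k *\<^sub>R x) ** matrix_inv g = k *\<^sub>R (g ** x ** matrix_inv g)" for k
    by (simp add: matrix_scalar_ac scalar_matrix_assoc)
  then show ?thesis by (auto simp: SU21_act_def span_singleton image_iff)
qed

text \<open>The map \<open>h\<close> carrying the first basis to the second is an isometry because
  the Gram matrices agree, and it intertwines \<open>c *\<^sub>R x\<close> with \<open>y\<close>.
  Only its determinant may have to be corrected.\<close>

lemma frame_conj:
  assumes "frame x G M" "frame y G (c *\<^sub>R M)" "c \<noteq> 0"
  shows "span {x} \<sim>\<^sub>S\<^sub>U span {y}"
proof -
  obtain P where P: "det P \<noteq> 0" "ctranspose P ** N21 ** P = G" "x ** P = P ** M"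
    using assms(1) by (auto simp: frame_def)
  obtain Q where Q: "det Q \<noteq> 0" "ctranspose Q ** N21 ** Q = G" "y ** Q = Q ** (c *\<^sub>R M)"
    using assms(2) by (auto simp: frame_def)
  note iP = matrix_inv_mult [OF P(1)]
  have dN: "det N21 = -1" by (simp add: mk3_simps)
  define h where "h = Q ** matrix_inv P"
  have hP: "h ** P = Q" by (simp add: h_def matrix_mul_assoc [symmetric] iP)
  have h: "ctranspose h ** N21 ** h = N21"
  proof -
    have "ctranspose h ** N21 ** h = ctranspose (matrix_inv P) ** (ctranspose Q ** N21 ** Q) ** matrix_inv P"
      by (simp add: h_def ctranspose_mult matrix_mul_assoc)
    also have "\<dots> = ctranspose (P ** matrix_inv P) ** N21 ** (P ** matrix_inv P)"
      by (simp only: Q(2) P(2) [symmetric] ctranspose_mult matrix_mul_assoc)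
    also have "\<dots> = N21" by (simp add: iP) (simp add: mk3_simps)
    finally show ?thesis .
  qed
  have "det (ctranspose h ** N21 ** h) = -1" using h dN by simp
  then have "cnj (det h) * det h = 1" by (simp add: det_mul det_ctranspose dN)
  then have "of_real ((cmod (det h))\<^sup>2) = (1::complex)"
    by (metis complex_norm_square mult.commute)
  then have "(cmod (det h))\<^sup>2 = 1" by (simp only: of_real_eq_1_iff)
  then have n1: "cmod (det h) = 1" by (simp add: power2_eq_1_iff) (smt (verit) norm_ge_zero)
  \<comment> \<open>A scalar matrix \<open>mat r\<close> has determinant \<open>r ^ 3\<close>, and
    modulus 1 keeps it an isometry.\<close>
  then obtain r where r: "r ^ 3 = inverse (det h)" "cmod r = 1"
    by (metis exists_unit_cube_root norm_inverse inverse_1)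
  define g where "g = mat r ** h"
  have comm: "mat r ** A = A ** mat r" for A :: cmat3
    by (cases A rule: mk3_cases) (simp add: mk3_simps mult.commute)
  have rr: "ctranspose (mat r) ** A ** mat r = A" for A :: cmat3
  proof -
    have "cnj r * r = 1" using r(2) by (metis complex_norm_square mult.commute of_real_1 one_power2)
    then have "ctranspose (mat r) ** mat r = (mat 1 :: cmat3)" by (simp add: mk3_simps)
    then show ?thesis by (metis comm matrix_mul_assoc matrix_mul_lid)
  qed
  have "det (mat r :: cmat3) = inverse (det h)"
    by (simp add: mk3_simps flip: r(1) power3_eq_cube)
  moreover have "det h \<noteq> 0" using n1 by auto
  ultimately have "det g = 1" by (simp add: g_def det_mul)
  moreover have "ctranspose g ** N21 ** g = N21"
  proof -
    have "ctranspose g ** N21 ** g = ctranspose h ** (ctranspose (mat r) ** N21 ** mat r) ** h"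
      by (simp add: g_def ctranspose_mult matrix_mul_assoc)
    then show ?thesis by (simp add: rr h)
  qed
  ultimately have g: "g \<in> SU21" by (simp add: SU21_iff)
  have "c *\<^sub>R (h ** x) ** P = c *\<^sub>R (h ** (x ** P))"
    by (simp only: scalar_matrix_assoc matrix_mul_assoc)
  also have "\<dots> = Q ** (c *\<^sub>R M)"
    by (simp only: P(3) matrix_mul_assoc hP matrix_scalar_ac scalar_matrix_assoc)
  also have "\<dots> = y ** h ** P"
    by (metis Q(3) hP matrix_mul_assoc)
  finally have "c *\<^sub>R (h ** x) ** (P ** matrix_inv P) = y ** h ** (P ** matrix_inv P)"
    by (simp add: matrix_mul_assoc)
  then have hx: "c *\<^sub>R (h ** x) = y ** h" by (simp add: iP)
  have "c *\<^sub>R (g ** x) = mat r ** (c *\<^sub>R (h ** x))"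
    by (simp only: g_def matrix_mul_assoc matrix_scalar_ac scalar_matrix_assoc)
  also have "\<dots> = y ** g"
    by (metis hx g_def comm matrix_mul_assoc)
  finally have "c *\<^sub>R (g ** x) = y ** g" .
  moreover have "g ** matrix_inv g = mat 1" using \<open>det g = 1\<close> by (simp add: matrix_inv_mult)
  ultimately have "c *\<^sub>R (g ** x ** matrix_inv g) = y"
    by (simp add: scalar_matrix_assoc) (simp add: matrix_mul_assoc [symmetric])
  then have "SU21_act g (span {x}) = span {y}"
    using assms(3) by (metis SU21_act_span span_singleton_scaleR)
  with g show ?thesis by (auto simp: SU21_conj_def)
qed

text \<open>A converse of \<open>frame_conj\<close>: equality of the lines fixes the generators only
  up to the real factor \<open>c\<close>, which is nonzero because \<open>y\<close> is.\<close>

lemma conj_imp: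
  assumes "span {x} \<sim>\<^sub>S\<^sub>U span {y}" "y \<noteq> 0"
  obtains g c where "det g = 1" "ctranspose g ** N21 ** g = N21" "c \<noteq> 0" "c *\<^sub>R (g ** x) = y ** g"
proof -
  obtain g where g: "g \<in> SU21" "SU21_act g (span {x}) = span {y}"
    using assms(1) by (auto simp: SU21_conj_def)
  then have eq: "span {g ** x ** matrix_inv g} = span {y}" by (simp add: SU21_act_span)
  then have "y \<in> span {g ** x ** matrix_inv g}" by (simp add: span_base)
  then obtain c where c: "y = c *\<^sub>R (g ** x ** matrix_inv g)" by (auto simp: span_singleton)
  then have "c \<noteq> 0" using assms(2) by auto
  have d: "det g = 1" "ctranspose g ** N21 ** g = N21" using g by (auto simp: SU21_iff)
  have "y ** g = c *\<^sub>R (g ** x ** (matrix_inv g ** g))"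
    by (simp add: c matrix_mul_assoc flip: scalar_matrix_assoc)
  then have "c *\<^sub>R (g ** x) = y ** g" using d by (simp add: matrix_inv_mult)
  with that d \<open>c \<noteq> 0\<close> show ?thesis by blast
qed

section \<open>Normal forms in a Witt basis\<close>

text \<open>The Gram matrix of a Witt basis: null vectors in first and third place that pair to 1,
  and a unit vector orthogonal to both.\<close>

definition W21 :: cmat3 where "W21 = mk3 0 0 1 0 1 0 1 0 0"

lemma frameI:
  "det P \<noteq> 0 \<Longrightarrow> ctranspose P ** N21 ** P = G \<Longrightarrow> x ** P = P ** M \<Longrightarrow> frame x G M"
  by (auto simp: frame_def)

text \<open>In this and the other frames over \<open>W21\<close> of generators, the columns of
  \<open>P\<close> form a Witt basis that starts with a null eigenvector, which makes the matrix
  upper triangular.\<close>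

lemma frame_V11:
  "frame (- A1 - 2 *\<^sub>R A2 - A4 + sqrt 2 *\<^sub>R A6 + sqrt 2 *\<^sub>R A8) W21 (mk3 0 0 (-4*\<i>) 0 0 0 0 0 0)"
  by (rule frameI [where P = "mk3 (1/2) (sqrt 2/2) (1/2) (1/2) (-sqrt 2/2) (1/2) (sqrt 2/2) 0 (-sqrt 2/2)"])
    (simp_all add: mk3_simps A_eqs W21_def complex_eq_iff field_simps)

lemma frame_V12:
  "frame (A3 + A4 + A7 - A8) W21
     (mk3 0 (sqrt 2*(1+\<i>)) 0 0 0 (- cnj (sqrt 2*(1+\<i>))) 0 0 0)"
  by (rule frameI [where P = "mk3 (sqrt 2/2) 0 (sqrt 2/2) 0 1 0 (sqrt 2/2) 0 (-sqrt 2/2)"])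
    (simp_all add: mk3_simps A_eqs W21_def complex_eq_iff field_simps)

lemma frame_V13:
  "frame (3 *\<^sub>R A1 + 6 *\<^sub>R A2 - 5 *\<^sub>R A4 - sqrt 2 *\<^sub>R A6 - sqrt 2 *\<^sub>R A8) W21
     (mk3 (-4*\<i>) 0 (4*\<i>) 0 (8*\<i>) 0 0 0 (-4*\<i>))"
  by (rule frameI [where P = "mk3 (1/2) (sqrt 2/2) (1/2) (1/2) (-sqrt 2/2) (1/2) (sqrt 2/2) 0 (-sqrt 2/2)"])
    (simp_all add: mk3_simps A_eqs W21_def complex_eq_iff field_simps)

lemma frame_V14:
  "frame (A1 + 2 *\<^sub>R A2 + 7 *\<^sub>R A4 - sqrt 2 *\<^sub>R A6 + sqrt 2 *\<^sub>R A8) W21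
     (mk3 (-4*\<i>) 0 (-4*\<i>) 0 (8*\<i>) 0 0 0 (-4*\<i>))"
  by (rule frameI [where P = "mk3 (1/2) (sqrt 2/2) (1/2) (-1/2) (sqrt 2/2) (-1/2) (-sqrt 2/2) 0 (sqrt 2/2)"])
    (simp_all add: mk3_simps A_eqs W21_def complex_eq_iff field_simps)

lemma frame_V15: "frame (A1 + l *\<^sub>R A2) N21 (mk3 \<i> 0 0 0 (\<i>*(l-1)) 0 0 0 (-\<i>*l))"
  by (rule frameI [where P = "mat 1"])
    (simp_all add: mk3_simps A_eqs algebra_simps)

lemma frame_V16: "frame (A5 - A7) W21 (mk3 (sqrt 2) 0 0 0 0 0 0 0 (-sqrt 2))"
  by (rule frameI [where P = "mk3 (1/2) (sqrt 2/2) (1/2) (-1/2) (sqrt 2/2) (-1/2) (sqrt 2/2) 0 (-sqrt 2/2)"])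
    (simp_all add: mk3_simps A_eqs W21_def complex_eq_iff field_simps)

lemma frame_V17: "frame (A1 - A2 + l *\<^sub>R A5) W21 (mk3 (l+\<i>) 0 0 0 (-2*\<i>) 0 0 0 (-l+\<i>))"
  by (rule frameI [where P = "mk3 (sqrt 2/2) 0 (sqrt 2/2) 0 1 0 (sqrt 2/2) 0 (-sqrt 2/2)"])
    (simp_all add: mk3_simps A_eqs W21_def complex_eq_iff field_simps)

text \<open>Skewness for \<open>W21\<close> relates entries that are mirror images in the
  antidiagonal. It makes the corner imaginary and carries the zero in position (2,1) over to (3,2);
  the trace fixes the middle entry.\<close>

lemma frame_W21_shape:
  assumes "frame x W21 M" "x \<in> su21" "M $ 2 $ 1 = 0" "M $ 3 $ 1 = 0"
  obtains \<mu> \<alpha> and \<delta> :: real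
  where "M = mk3 \<mu> \<alpha> (\<i> * \<delta>) 0 (cnj \<mu> - \<mu>) (- cnj \<alpha>) 0 0 (- cnj \<mu>)"
proof -
  obtain a b c d e f g h k where M: "M = mk3 a b c d e f g h k" by (rule mk3_cases)
  have "d = 0" "g = 0" using assms(3,4) by (simp_all add: M)
  moreover have "trace M = 0" "ctranspose M ** W21 + W21 ** M = 0"
    using frame_skew [OF assms(1,2)] by auto
  ultimately have *: "a + e + k = 0" "h = 0" "cnj a + k = 0" "cnj b + f = 0" "cnj c + c = 0"
    by (simp_all add: M mk3_simps mk3_0 W21_def)
  have "c = \<i> * Im c" using *(5) by (simp add: complex_eq_iff)
  moreover have "k = - cnj a" "e = cnj a - a" "f = - cnj b" using * by algebra+
  ultimately have "M = mk3 a b (\<i> * Im c) 0 (cnj a - a) (- cnj b) 0 0 (- cnj a)"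
    using \<open>d = 0\<close> \<open>g = 0\<close> \<open>h = 0\<close> by (simp add: M mk3_eq_iff)
  then show ?thesis by (rule that)
qed

section \<open>Normal forms and the entries of the list\<close>

lemma conj_diagonal:
  fixes a b c :: real
  assumes "frame x N21 (mk3 (\<i> * a) 0 0 0 (\<i> * b) 0 0 0 (\<i> * c))" "a + b + c = 0" "x \<noteq> 0"
  shows "\<exists>\<mu>. span {x} \<sim>\<^sub>S\<^sub>U subalg (V15 \<mu>)"
proof -
  have ab: "a \<noteq> 0 \<or> b \<noteq> 0"
  proof (rule ccontr)
    assume "\<not> (a \<noteq> 0 \<or> b \<noteq> 0)"
    then have "a = 0" "b = 0" "c = 0" using assms(2) by auto
    then obtain P where P: "det P \<noteq> 0" "x ** P = 0" using assms(1)
      by (auto simp: frame_def simp flip: mk3_0)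
    have "x = x ** P ** matrix_inv P" using matrix_inv_mult [OF P(1)] by (simp flip: matrix_mul_assoc)
    then show False using P(2) assms(3) by simp
  qed
  have *: "\<exists>\<mu>. span {x} \<sim>\<^sub>S\<^sub>U subalg (V15 \<mu>)"
    if "frame x N21 (mk3 (\<i> * a) 0 0 0 (\<i> * b) 0 0 0 (\<i> * c))" "a + b + c = 0" "a \<noteq> 0" for a b c :: real
  proof -
    have c: "c = - a - b" using that(2) by simp
    \<comment> \<open>The second diagonal entry of the \<open>V15\<close> form is
      \<open>\<i> * (\<mu> - 1)\<close>, whence \<open>\<mu> = b/a + 1\<close>; the third entry then
      agrees by the trace.\<close>
    have "(1/a) *\<^sub>R mk3 (\<i> * a) 0 0 0 (\<i> * b) 0 0 0 (\<i> * c) =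
      mk3 \<i> 0 0 0 (\<i>*(complex_of_real (b/a+1)-1)) 0 0 0 (-\<i>*complex_of_real (b/a+1))"
      using that(3) by (simp add: mk3_simps c field_simps)
    then show ?thesis
      using frame_conj [OF that(1), of "A1 + (b/a+1) *\<^sub>R A2" "1/a"] frame_V15 [of "b/a+1"] that(3)
      by (intro exI [of _ "b/a+1"]) simp
  qed
  show ?thesis
  proof (cases "a = 0")
    case True
    \<comment> \<open>Swapping the two positive basis vectors moves the nonzero entry to the
      front.\<close>
    have "frame x N21 (mk3 (\<i> * b) 0 0 0 (\<i> * a) 0 0 0 (\<i> * c))"
      by (rule frame_change [OF assms(1), of "mk3 0 1 0 1 0 0 0 0 1"]) (simp_all add: mk3_simps)
    then show ?thesis using * [of b a c] ab True assms(2) by simp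
  next
    case False
    then show ?thesis using * assms by blast
  qed
qed

lemma conj_hyperbolic:
  fixes a b :: real
  assumes "frame x W21 (mk3 (b + \<i> * a) 0 0 0 (- 2 * \<i> * a) 0 0 0 (- b + \<i> * a))" "b \<noteq> 0"
  shows "span {x} \<sim>\<^sub>S\<^sub>U subalg V16 \<or> (\<exists>\<mu>. \<mu> \<noteq> 0 \<and> span {x} \<sim>\<^sub>S\<^sub>U subalg (V17 \<mu>))"
proof (cases "a = 0")
  case True
  have "frame (A5 - A7) W21 ((sqrt 2 / b) *\<^sub>R mk3 (b + \<i> * a) 0 0 0 (- 2 * \<i> * a) 0 0 0 (- b + \<i> * a))"
    using frame_V16 assms(2) by (simp add: mk3_simps True)
  then show ?thesis using frame_conj [OF assms(1)] assms(2) by simp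
next
  case False
  have "(1 / a) *\<^sub>R mk3 (b + \<i> * a) 0 0 0 (- 2 * \<i> * a) 0 0 0 (- b + \<i> * a) =
    mk3 (complex_of_real (b/a)+\<i>) 0 0 0 (-2*\<i>) 0 0 0 (-complex_of_real (b/a)+\<i>)"
    using False by (simp add: mk3_simps field_simps)
  then show ?thesis
    using frame_conj [OF assms(1), of "A1 - A2 + (b/a) *\<^sub>R A5" "1/a"] frame_V17 [of "b/a"] False assms(2)
    by (intro disjI2 exI [of _ "b/a"]) simp
qed

text \<open>The matrix diag(k, 1, 1/k) preserves \<open>W21\<close> and divides the corner entry by
  \<open>k\<^sup>2\<close>, so only the sign of the corner can matter.\<close>

lemma frame_parabolic_rescale:
  fixes a \<delta> \<delta>' :: real
  assumes "frame x W21 (mk3 (\<i> * a) 0 (\<i> * \<delta>) 0 (- 2 * \<i> * a) 0 0 0 (\<i> * a))" "\<delta> / \<delta>' > 0"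
  shows "frame x W21 (mk3 (\<i> * a) 0 (\<i> * \<delta>') 0 (- 2 * \<i> * a) 0 0 0 (\<i> * a))"
proof -
  define k where "k = sqrt (\<delta> / \<delta>')"
  have k: "k > 0" "k * k = \<delta> / \<delta>'"
    using assms(2) by (simp_all add: k_def flip: power2_eq_square)
  then have "\<delta>' * k\<^sup>2 = \<delta>" using assms(2) by (auto simp: power2_eq_square)
  then have "complex_of_real \<delta> = \<delta>' * complex_of_real k * complex_of_real k"
    by (simp add: power2_eq_square flip: of_real_mult)
  with k(1) show ?thesis
    by (intro frame_change [OF assms(1), of "mk3 k 0 0 0 1 0 0 0 (1/k)"])
      (simp_all add: mk3_simps W21_def)
qed

text \<open>A negative multiple of \<open>x\<close> has both \<open>a\<close> and
  \<open>\<delta>\<close> reversed. For \<open>a = 0\<close> the sign of \<open>\<delta>\<close> is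
  therefore absorbed by the scalar; otherwise the sign of \<open>\<delta> / a\<close> selects
  \<open>V13\<close> (negative) or \<open>V14\<close> (positive).\<close>

lemma conj_parabolic:
  fixes a \<delta> :: real
  assumes "frame x W21 (mk3 (\<i> * a) 0 (\<i> * \<delta>) 0 (- 2 * \<i> * a) 0 0 0 (\<i> * a))" "\<delta> \<noteq> 0"
  shows "\<exists>p\<in>{V11, V13, V14}. span {x} \<sim>\<^sub>S\<^sub>U subalg p"
proof (cases "a = 0")
  case True
  have "frame (- A1 - 2 *\<^sub>R A2 - A4 + sqrt 2 *\<^sub>R A6 + sqrt 2 *\<^sub>R A8) W21
    ((-4/\<delta>) *\<^sub>R mk3 (\<i> * a) 0 (\<i> * \<delta>) 0 (- 2 * \<i> * a) 0 0 0 (\<i> * a))"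
    using frame_V11 assms(2) by (simp add: mk3_simps True)
  from frame_conj [OF assms(1) this] show ?thesis using assms(2) by simp
next
  case False
  show ?thesis
  proof (cases "\<delta> / (-a) > 0")
    case True
    have "frame (3 *\<^sub>R A1 + 6 *\<^sub>R A2 - 5 *\<^sub>R A4 - sqrt 2 *\<^sub>R A6 - sqrt 2 *\<^sub>R A8) W21
      ((-4/a) *\<^sub>R mk3 (\<i> * a) 0 (\<i> * complex_of_real (-a)) 0 (- 2 * \<i> * a) 0 0 0 (\<i> * a))"
      using frame_V13 False by (simp add: mk3_simps)
    from frame_conj [OF frame_parabolic_rescale [OF assms(1) True] this] show ?thesis using False by simp
  next
    case F: False
    then have "\<delta> / a > 0" using assms(2) False by (simp add: field_simps split: if_splits) (smt (verit) divide_eq_0_iff)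
    have "frame (A1 + 2 *\<^sub>R A2 + 7 *\<^sub>R A4 - sqrt 2 *\<^sub>R A6 + sqrt 2 *\<^sub>R A8) W21
      ((-4/a) *\<^sub>R mk3 (\<i> * a) 0 (\<i> * a) 0 (- 2 * \<i> * a) 0 0 0 (\<i> * a))"
      using frame_V14 False by (simp add: mk3_simps)
    from frame_conj [OF frame_parabolic_rescale [OF assms(1) \<open>\<delta> / a > 0\<close>] this] show ?thesis using False by simp
  qed
qed

lemma conj_regular_nilpotent:
  fixes \<delta> :: real
  assumes "frame x W21 (mk3 0 \<alpha> (\<i> * \<delta>) 0 0 (- cnj \<alpha>) 0 0 0)" "\<alpha> \<noteq> 0"
  shows "span {x} \<sim>\<^sub>S\<^sub>U subalg V12"
proof -
  \<comment> \<open>This \<open>s\<close> solves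
    \<open>\<alpha> * cnj s - s * cnj \<alpha> = \<i> * \<delta>\<close>, so the unipotent change of
    Witt basis clears the corner.\<close>
  define s where "s = - \<i> * \<delta> / (2 * cnj \<alpha>)"
  have s: "s * cnj \<alpha> = - \<i> * \<delta> / 2" "cnj s * \<alpha> = \<i> * \<delta> / 2"
    using assms(2) by (simp_all add: s_def)
  have 1: "frame x W21 (mk3 0 \<alpha> 0 0 0 (- cnj \<alpha>) 0 0 0)"
    by (rule frame_change [OF assms(1), of "mk3 1 s (- s * cnj s / 2) 0 1 (- cnj s) 0 0 1"])
      (use s in \<open>simp_all add: mk3_simps W21_def algebra_simps\<close>)
  define k where "k = \<alpha> / (sqrt 2*(1+\<i>))"
  have n: "complex_of_real (sqrt 2) * (1 + \<i>) \<noteq> 0" by (simp add: complex_eq_iff)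
  then have k: "k \<noteq> 0" "\<alpha> = k * (sqrt 2*(1+\<i>))" using assms(2) by (simp_all add: k_def)
  \<comment> \<open>The isometry diag(k, 1, 1 / cnj k) of \<open>W21\<close> divides the entry
    \<open>\<alpha>\<close> by \<open>k\<close>.\<close>
  have "frame x W21 (mk3 0 (sqrt 2*(1+\<i>)) 0 0 0 (- cnj (sqrt 2*(1+\<i>))) 0 0 0)"
    by (rule frame_change [OF 1, of "mk3 k 0 0 0 1 0 0 0 (1 / cnj k)"])
      (use k(1) in \<open>simp_all add: mk3_simps W21_def k(2)\<close>)
  then show ?thesis using frame_conj [OF _ _, of x _ _ "A3 + A4 + A7 - A8" 1] frame_V12 by simp
qed

text \<open>First \<open>\<alpha>\<close> is removed where possible; the only obstruction is
  \<open>\<mu> = 0\<close>, the regular nilpotent case. Without \<open>\<alpha>\<close>, the real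
  part of \<open>\<mu>\<close> separates the hyperbolic type from the diagonalisable and parabolic
  ones.\<close>

lemma conj_of_W21_frame:
  fixes \<delta> :: real
  assumes fr: "frame x W21 (mk3 \<mu> \<alpha> (\<i> * \<delta>) 0 (cnj \<mu> - \<mu>) (- cnj \<alpha>) 0 0 (- cnj \<mu>))" and "x \<noteq> 0"
  shows "\<exists>p\<in>labels. span {x} \<sim>\<^sub>S\<^sub>U subalg p"
proof -
  \<comment> \<open>The corner is quantified anew because removing \<open>\<alpha>\<close> changes
    it.\<close>
  have red: ?thesis if "frame x W21 (mk3 \<mu> 0 (\<i> * \<delta>) 0 (cnj \<mu> - \<mu>) 0 0 0 (- cnj \<mu>))" for \<delta> :: real
  proof (cases "Re \<mu> = 0")
    case True
    have fr: "frame x W21 (mk3 (\<i> * Im \<mu>) 0 (\<i> * \<delta>) 0 (- 2 * \<i> * Im \<mu>) 0 0 0 (\<i> * Im \<mu>))"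
      using that True
      by (elim back_subst [where P = "frame x W21"]) (simp add: mk3_eq_iff complex_eq_iff)
    show ?thesis
    proof (cases "\<delta> = 0")
      case True
      \<comment> \<open>The two null vectors combine to orthogonal vectors of square 1 and -1 in the
        same eigenspace.\<close>
      have "frame x N21 (mk3 (\<i> * Im \<mu>) 0 0 0 (\<i> * complex_of_real (- 2 * Im \<mu>)) 0 0 0 (\<i> * Im \<mu>))"
        by (rule frame_change [OF fr, of "mk3 1 0 1 0 1 0 (1/2) 0 (-1/2)"])
          (simp_all add: mk3_simps W21_def True)
      then show ?thesis using conj_diagonal [of x] assms(2) by (fastforce simp: labels_def)
    next
      case False
      then show ?thesis using conj_parabolic [OF fr] by (auto simp: labels_def)
    qed
  next
    case False
    \<comment> \<open>Conjugation by this unipotent matrix adds \<open>2 * t * Re \<mu>\<close> to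
      the coefficient \<open>\<delta>\<close> of the corner.\<close>
    define t where "t = - \<delta> / (2 * Re \<mu>)"
    have t: "\<delta> = - 2 * t * Re \<mu>" using False by (simp add: t_def)
    have "frame x W21 (mk3 (Re \<mu> + \<i> * Im \<mu>) 0 0 0 (- 2 * \<i> * Im \<mu>) 0 0 0 (- Re \<mu> + \<i> * Im \<mu>))"
      by (rule frame_change [OF that, of "mk3 1 0 (\<i> * t) 0 1 0 0 0 1"])
        (simp_all add: mk3_simps W21_def t complex_eq_iff)
    from conj_hyperbolic [OF this False] show ?thesis by (auto simp: labels_def simp del: subalg.simps)
  qed
  consider "\<alpha> = 0" | "\<mu> = 0" "\<alpha> \<noteq> 0" | "\<mu> \<noteq> 0" by auto
  then show ?thesis
  proof cases
    case 1
    then show ?thesis using red fr by simp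
  next
    case 2
    then show ?thesis using conj_regular_nilpotent [of x \<alpha> \<delta>] fr by (auto simp: labels_def)
  next
    case 3
    \<comment> \<open>This is the difference of the first two diagonal entries; it cannot vanish
      since \<open>cnj \<mu>\<close> and \<open>2 * \<mu>\<close> have different moduli.\<close>
    then have ne: "cnj \<mu> - 2 * \<mu> \<noteq> 0" by (auto simp: complex_eq_iff)
    define s where "s = \<alpha> / (cnj \<mu> - 2 * \<mu>)"
    have s: "\<alpha> = s * (cnj \<mu> - 2 * \<mu>)" using ne by (simp add: s_def)
    have "frame x W21 (mk3 \<mu> 0 (\<i> * complex_of_real (\<delta> + 3 * Im \<mu> * (Re s * Re s + Im s * Im s)))
        0 (cnj \<mu> - \<mu>) 0 0 0 (- cnj \<mu>))"
      by (rule frame_change [OF fr, of "mk3 1 s (- s * cnj s / 2) 0 1 (- cnj s) 0 0 1"])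
        (simp_all add: mk3_simps W21_def s complex_eq_iff field_simps)
    then show ?thesis by (rule red)
  qed
qed

section \<open>Existence of a negative or null eigenvector\<close>

definition herm :: "complex^3 \<Rightarrow> complex^3 \<Rightarrow> complex" where
  "herm u v = u$1 * cnj (v$1) + u$2 * cnj (v$2) - u$3 * cnj (v$3)"

definition hq :: "complex^3 \<Rightarrow> real" where
  "hq v = (cmod (v$1))\<^sup>2 + (cmod (v$2))\<^sup>2 - (cmod (v$3))\<^sup>2"

lemma herm_self: "herm v v = of_real (hq v)"
  unfolding herm_def hq_def of_real_add of_real_diff complex_norm_square ..

lemma herm_smult: "herm (t *s u) v = t * herm u v" "herm u (t *s v) = cnj t * herm u v"
  by (simp_all add: herm_def algebra_simps)

lemma su21_cases:
  assumes "x \<in> su21"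
  obtains A B :: real and p q r where
    "x = mk3 (\<i> * A) p q (- cnj p) (\<i> * B) r (cnj q) (cnj r) (- (\<i> * A) - \<i> * B)"
proof -
  obtain a b c d e f g h k where x: "x = mk3 a b c d e f g h k" by (rule mk3_cases)
  have "(ctranspose x ** N21 + N21 ** x) $ i $ j = 0" for i j
    using assms by (simp add: su21_iff)
  note eq = this [unfolded x mk3_simps]
  have "\<i> * Im a = a" using eq [of 1 1] by (simp add: complex_eq_iff)
  moreover have "\<i> * Im e = e" using eq [of 2 2] by (simp add: complex_eq_iff)
  moreover have "- cnj b = d" using eq [of 2 1] by (simp add: add_eq_0_iff)
  moreover have "cnj c = g" using eq [of 3 1] by simp
  moreover have "cnj f = h" using eq [of 3 2] by simp
  moreover have "- a - e = k"
  proof -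
    have "trace x = 0" using assms by (simp add: su21_iff)
    then show ?thesis unfolding x mk3_trace by algebra
  qed
  ultimately have "x = mk3 (\<i> * Im a) b c (- cnj b) (\<i> * Im e) f (cnj c) (cnj f) (- (\<i> * Im a) - \<i> * Im e)"
    by (simp only: x)
  then show ?thesis by (rule that)
qed

lemma herm_su21: assumes "x \<in> su21" shows "herm (x *v u) v = - herm u (x *v v)"
proof -
  obtain A B :: real and p q r where
    x: "x = mk3 (\<i> * A) p q (- cnj p) (\<i> * B) r (cnj q) (cnj r) (- (\<i> * A) - \<i> * B)"
    using su21_cases [OF assms] .
  show ?thesis
    by (cases u rule: vec3_cases; cases v rule: vec3_cases)
      (simp add: x mk3_simps herm_def algebra_simps)
qed

lemma frame_of_eigenvector:
  assumes "det P \<noteq> 0" "ctranspose P ** N21 ** P = G" "x *v (P *v e) = t *s (P *v e)"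
  obtains M where "frame x G M" "M *v e = t *s e"
proof
  define M where "M = matrix_inv P ** x ** P"
  note i = matrix_inv_mult [OF assms(1)]
  have "x ** P = P ** M"
    by (simp add: M_def matrix_mul_assoc i)
  then show "frame x G M" using assms by (auto simp: frame_def)
  have "M *v e = matrix_inv P *v (x *v (P *v e))"
    by (simp only: M_def matrix_vector_mul_assoc matrix_mul_assoc)
  also have "\<dots> = t *s (matrix_inv P ** P *v e)"
    unfolding assms(3) by (simp only: vector_scalar_commute matrix_vector_mul_assoc)
  finally show "M *v e = t *s e" by (simp add: i)
qed

lemma eigenvector_rescale:
  assumes "x *v v = t *s v" "v = k *s w" "(k::'a::field) \<noteq> 0" shows "x *v w = t *s w"
proof -
  have "k *s (x *v w) = k *s (t *s w)"
    using assms by (simp add: vector_scalar_commute vector_smult_assoc mult.commute)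
  then show ?thesis using assms(3) by (simp only: vector_mul_lcancel) simp
qed

section \<open>Reduction to the list when a null or negative eigenvector is known\<close>

lemma conj_of_null_eigenvector:
  assumes x: "x \<in> su21" "x \<noteq> 0" and v: "x *v v = t *s v" "v \<noteq> 0" "hq v = 0"
  shows "\<exists>p\<in>labels. span {x} \<sim>\<^sub>S\<^sub>U subalg p"
proof -
  obtain p q r where vv: "v = vector [p, q, r]" by (rule vec3_cases)
  \<comment> \<open>The form is positive definite on vectors with last coordinate zero.\<close>
  have r: "r \<noteq> 0" using v(2,3) by (auto simp: vv hq_def vec3_0 vec3_eq_iff sum_power2_eq_zero_iff)
  define a b where "a = p / r" and "b = q / r"
  have ab: "p = r * a" "q = r * b" using r by (simp_all add: a_def b_def)
  have "(cmod r)\<^sup>2 * ((cmod a)\<^sup>2 + (cmod b)\<^sup>2 - 1) = 0"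
    using v(3) by (simp add: hq_def vv ab norm_mult power_mult_distrib algebra_simps)
  then have "(cmod a)\<^sup>2 + (cmod b)\<^sup>2 = 1" using r by simp
  then have n: "a * cnj a + b * cnj b = 1"
    by (metis complex_norm_square of_real_1 of_real_add)
  \<comment> \<open>After scaling, the eigenvector is (a, b, 1). It is completed by the unit vector
    (-cnj b, cnj a, 0) and the null vector (a, b, -1)/2 to a Witt basis.\<close>
  define P where "P = mk3 a (- cnj b) (a/2) b (cnj a) (b/2) 1 0 (-1/2)"
  define e :: "complex^3" where "e = vector [1, 0, 0]"
  have G: "ctranspose P ** N21 ** P = W21"
    using n by (simp add: P_def mk3_simps W21_def field_simps)
  have "det P = - (a * cnj a + b * cnj b)" by (simp add: P_def mk3_simps field_simps)
  then have d: "det P \<noteq> 0" using n by simp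
  have "v = r *s (P *v e)" by (simp add: vv ab P_def e_def mk3_simps)
  then have "x *v (P *v e) = t *s (P *v e)" using eigenvector_rescale v(1) r by blast
  from frame_of_eigenvector [OF d G this]
  obtain M where M: "frame x W21 M" "M *v e = t *s e" .
  have "M $ 2 $ 1 = 0" "M $ 3 $ 1 = 0"
    using M(2) by (cases M rule: mk3_cases; simp add: e_def mk3_simps)+
  from frame_W21_shape [OF M(1) x(1) this] conj_of_W21_frame x(2) M(1) show ?thesis by metis
qed

text \<open>The orthogonal complement of the eigenvector is invariant and positive definite, so
  \<open>x\<close> acts on it by a skew-Hermitian 2 by 2 block, which is unitarily
  diagonalisable.\<close>

lemma conj_of_negative_eigenvector:
  assumes x: "x \<in> su21" "x \<noteq> 0" and v: "x *v v = t *s v" "hq v < 0"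
  shows "\<exists>\<mu>. span {x} \<sim>\<^sub>S\<^sub>U subalg (V15 \<mu>)"
proof -
  obtain p0 q0 r where vv: "v = vector [p0, q0, r]" by (rule vec3_cases)
  have r: "r \<noteq> 0"
  proof
    assume "r = 0"
    then have "hq v \<ge> 0" by (simp add: vv hq_def)
    then show False using v(2) by simp
  qed
  \<comment> \<open>Dividing \<open>v\<close> by \<open>r / g\<close> gives (p, q, g) with
    \<open>hq\<close> equal to -1 and a positive last coordinate.\<close>
  define g where "g = cmod r / sqrt (- hq v)"
  define p q where "p = g * p0 / r" and "q = g * q0 / r"
  have g: "g > 0" using r v(2) by (simp add: g_def)
  have g2: "g\<^sup>2 = (cmod r)\<^sup>2 / (- hq v)" using v(2) by (simp add: g_def power_divide)
  have pq: "p0 = (r / g) * p" "q0 = (r / g) * q" using r g by (simp_all add: p_def q_def)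
  have "(cmod p)\<^sup>2 + (cmod q)\<^sup>2 = g\<^sup>2 / (cmod r)\<^sup>2 * ((cmod p0)\<^sup>2 + (cmod q0)\<^sup>2)"
    using g by (simp add: p_def q_def norm_mult norm_divide power_divide power_mult_distrib algebra_simps)
  also have "(cmod p0)\<^sup>2 + (cmod q0)\<^sup>2 = hq v + (cmod r)\<^sup>2" by (simp add: vv hq_def)
  also have "g\<^sup>2 / (cmod r)\<^sup>2 * (hq v + (cmod r)\<^sup>2) = g\<^sup>2 - 1"
    using r v(2) by (simp add: g2 field_simps)
  finally have "complex_of_real ((cmod p)\<^sup>2 + (cmod q)\<^sup>2) = of_real (g\<^sup>2 - 1)" by (simp only:)
  then have n: "p * cnj p + q * cnj q = of_real g * of_real g - 1"
    unfolding of_real_add of_real_diff complex_norm_square by (simp add: power2_eq_square)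
  define h where "h = 1 / (1 + g)"
  have "(1 + g) * h = 1" using g by (simp add: h_def)
  then have "complex_of_real ((1 + g) * h) = 1" by (simp only: of_real_1)
  then have h: "(1 + complex_of_real g) * h = 1" by simp
  have h1: "complex_of_real h * (p * cnj p + q * cnj q) = complex_of_real g - 1" unfolding n using h by algebra
  have hh: "complex_of_real h * h * (p * cnj p + q * cnj q) + 2 * complex_of_real h = 1" unfolding n using h by algebra
  \<comment> \<open>The boost that takes the third basis vector to (p, q, g);
    \<open>h = 1 / (1 + g)\<close> is the coefficient that makes it an isometry.\<close>
  define P where "P = mk3 (1 + h*p*cnj p) (h*p*cnj q) p (h*q*cnj p) (1 + h*q*cnj q) q (cnj p) (cnj q) g"
  define e :: "complex^3" where "e = vector [0, 0, 1]"
  have G: "ctranspose P ** N21 ** P = N21"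
    unfolding P_def mk3_simps complex_cnj_add complex_cnj_mult complex_cnj_cnj complex_cnj_one
      complex_cnj_complex_of_real
    apply (intro conjI)
    subgoal using hh by algebra
    subgoal using hh by algebra
    subgoal using h1 by algebra
    subgoal using hh by algebra
    subgoal using hh by algebra
    subgoal using h1 by algebra
    subgoal using h1 by algebra
    subgoal using h1 by algebra
    subgoal using n by algebra
    done
  have "det (ctranspose P ** N21 ** P) = -1" unfolding G by (simp add: mk3_simps)
  then have d: "det P \<noteq> 0" by (auto simp: det_mul)
  have "v = (r / g) *s (P *v e)" using g by (simp add: vv pq P_def e_def mk3_simps)
  then have "x *v (P *v e) = t *s (P *v e)" by (rule eigenvector_rescale [OF v(1)]) (use r g in simp)
  from frame_of_eigenvector [OF d G this]
  obtain M where M: "frame x N21 M" "M *v e = t *s e" .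
  have "trace M = 0" "ctranspose M ** N21 + N21 ** M = 0" using frame_skew [OF M(1) x(1)] by auto
  then have "M \<in> su21" by (simp add: su21_iff)
  then obtain A B :: real and w s1 s2 where
    M1: "M = mk3 (\<i> * A) w s1 (- cnj w) (\<i> * B) s2 (cnj s1) (cnj s2) (- (\<i> * A) - \<i> * B)"
    by (rule su21_cases)
  \<comment> \<open>The third basis vector is an eigenvector of \<open>M\<close>; by skewness the
    third row vanishes off the diagonal as well.\<close>
  have "s1 = 0" "s2 = 0" using M(2) by (simp_all add: M1 e_def mk3_simps)
  then have fr: "frame x N21 (mk3 (\<i> * A) w 0 (- cnj w) (\<i> * B) 0 0 0 (\<i> * (- A - B)))"
    using M(1) by (simp add: M1 algebra_simps)
  show ?thesis
  proof (cases "w = 0")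
    case True
    then show ?thesis using conj_diagonal [of x A B "-A-B"] fr x(2) by simp
  next
    case False
    \<comment> \<open>The eigenvalues of the block are \<open>\<i> * (A + L)\<close> and
      \<open>\<i> * (B - L)\<close>, where \<open>L\<close> is a root of the quadratic with
      discriminant \<open>D * D\<close>. The factor \<open>k\<close> normalises the
      eigenvectors.\<close>
    define D where "D = sqrt ((A - B)\<^sup>2 + 4 * (cmod w)\<^sup>2)"
    define L where "L = (B - A + D) / 2"
    have D2: "D * D = (A - B)\<^sup>2 + 4 * (cmod w)\<^sup>2"
      unfolding D_def by (simp flip: power2_eq_square)
    have "L * L + (A - B) * L = (cmod w)\<^sup>2"
      using D2 by (simp add: L_def field_simps power2_eq_square)
    then have "complex_of_real (L * L + (A - B) * L) = of_real ((cmod w)\<^sup>2)" by (simp only:)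
    then have L: "complex_of_real L * L + (complex_of_real A - B) * L = w * cnj w"
      unfolding complex_norm_square by simp
    define m where "m = sqrt (L * L + (cmod w)\<^sup>2)"
    have "L * L + (cmod w)\<^sup>2 > 0" using False by (simp add: add_nonneg_pos)
    then have m: "m > 0" "m * m = L * L + (cmod w)\<^sup>2" by (simp_all add: m_def)
    define k where "k = 1 / m"
    have "k * k * (L * L + (cmod w)\<^sup>2) = 1" using m(1) by (simp add: k_def flip: m(2))
    then have "complex_of_real (k * k * (L * L + (cmod w)\<^sup>2)) = 1" by (simp only: of_real_1)
    then have k: "complex_of_real k * k * (complex_of_real L * L + w * cnj w) = 1"
      unfolding of_real_mult of_real_add complex_norm_square .
    have i: "\<i> * \<i> = -1" by simp
    define S where "S = mk3 (- \<i> * k * w) (- complex_of_real k * L) 0 (complex_of_real k * L) (\<i> * k * cnj w) 0 0 0 1"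
    have "frame x N21 (mk3 (\<i> * complex_of_real (A + L)) 0 0 0 (\<i> * complex_of_real (B - L)) 0 0 0 (\<i> * (- A - B)))"
    proof (rule frame_change [OF fr, of S])
      have "det S = 1" unfolding S_def mk3_simps using k i by algebra
      then show "det S \<noteq> 0" by simp
      show "ctranspose S ** N21 ** S = N21"
        unfolding S_def mk3_simps complex_cnj_add complex_cnj_mult complex_cnj_cnj complex_cnj_one
          complex_cnj_complex_of_real complex_cnj_minus complex_cnj_i complex_cnj_zero
        by (intro conjI; (algebra | use k i in algebra))
      show "mk3 (\<i> * A) w 0 (- cnj w) (\<i> * B) 0 0 0 (\<i> * (- A - B)) ** S =
        S ** mk3 (\<i> * complex_of_real (A + L)) 0 0 0 (\<i> * complex_of_real (B - L)) 0 0 0 (\<i> * (- A - B))"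
        unfolding S_def mk3_simps of_real_add of_real_diff of_real_minus
        by (intro conjI; (algebra | use L i in algebra))
    qed
    then show ?thesis using conj_diagonal [of x "A + L" "B - L" "-A-B"] x(2) by simp
  qed
qed

section \<open>Construction of an eigenvector that is not positive\<close>

text \<open>The sign of the last coordinate is that of \<open>N21\<close>; it makes the product
  \<open>herm\<close>-orthogonal to both factors.\<close>

definition cross :: "complex^3 \<Rightarrow> complex^3 \<Rightarrow> complex^3" where
  "cross v w = vector [cnj (v$2 * w$3 - v$3 * w$2), cnj (v$3 * w$1 - v$1 * w$3),
    - cnj (v$1 * w$2 - v$2 * w$1)]"

text \<open>Lagrange's identity, with the sign opposite to the Euclidean one because the form has
  determinant -1.\<close>

lemma herm_cross: "herm (cross v w) (cross v w) = herm v w * herm w v - herm v v * herm w w"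
  by (cases v rule: vec3_cases; cases w rule: vec3_cases)
    (simp add: cross_def herm_def algebra_simps)

text \<open>Conjugating the cofactor identity \<open>(xv) \<times> w + v \<times> (xw) = - x\<^sup>T (v \<times> w)\<close>, valid for traceless \<open>x\<close>.\<close>

lemma vec3_add: "vector [a, b, c] + vector [a', b', c'] = (vector [a + a', b + b', c + c'] :: 'a::ab_group_add^3)"
  by (simp add: vec_eq_iff forall_3)

lemma su21_cross:
  assumes "x \<in> su21"
  shows "x *v cross v w = cross (x *v v) w + cross v (x *v w)"
proof -
  obtain A B :: real and p q r where
    x: "x = mk3 (\<i> * A) p q (- cnj p) (\<i> * B) r (cnj q) (cnj r) (- (\<i> * A) - \<i> * B)"
    using su21_cases [OF assms] .
  obtain v1 v2 v3 where v: "v = vector [v1, v2, v3]" by (rule vec3_cases)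
  obtain w1 w2 w3 where w: "w = vector [w1, w2, w3]" by (rule vec3_cases)
  show ?thesis
    unfolding x v w cross_def by (simp add: mk3_simps vec3_add algebra_simps)
qed

lemma eigenvector_of_det_0:
  fixes x :: "'a::field^'n^'n"
  assumes "det (x - mat t) = 0" obtains v where "v \<noteq> 0" "x *v v = t *s v"
proof -
  have "\<not> (\<exists>B. B ** (x - mat t) = mat 1)"
    using assms by (metis det_I det_mul mult_zero_right zero_neq_one)
  then obtain v where v: "v \<noteq> 0" "(x - mat t) *v v = 0" by (auto simp: matrix_left_invertible_ker)
  have "mat t *v v = t *s v"
    by (simp add: vec_eq_iff matrix_vector_mult_def mat_def if_distrib [of "\<lambda>a. a * _"] cong: if_cong)
  then show ?thesis using v that [of v] by (simp add: matrix_vector_mult_diff_rdistrib)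
qed

text \<open>Positive eigenvectors have imaginary eigenvalues, so different eigenvalues make them
  orthogonal. Lagrange's identity then gives their cross product a negative square.\<close>

lemma nonpositive_eigenvector_of_distinct:
  assumes x: "x \<in> su21" and v: "v \<noteq> 0" "x *v v = t *s v" and w: "w \<noteq> 0" "x *v w = s *s w"
    and ne: "t \<noteq> s"
  shows "\<exists>u r. u \<noteq> 0 \<and> hq u \<le> 0 \<and> x *v u = r *s u"
proof (cases "hq v \<le> 0 \<or> hq w \<le> 0")
  case True
  then show ?thesis using v w by blast
next
  case False
  then have pos: "hq v > 0" "hq w > 0" by auto
  have im: "cnj t = - t" if "hq v > 0" "x *v v = t *s v" for v t
  proof -
    have "t * herm v v = - (cnj t * herm v v)"
      using herm_su21 [OF x, of v v] that(2) by (simp add: herm_smult)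
    then have "(t + cnj t) * herm v v = 0" by (simp add: algebra_simps)
    then show ?thesis using that(1) by (simp add: herm_self add_eq_0_iff)
  qed
  have "t * herm v w = - (cnj s * herm v w)"
    using herm_su21 [OF x, of v w] v(2) w(2) by (simp add: herm_smult)
  then have "(t - s) * herm v w = 0" using im [OF pos(2) w(2)] by (simp add: algebra_simps)
  then have 0: "herm v w = 0" using ne by simp
  have "complex_of_real (hq (cross v w)) = of_real (- (hq v * hq w))"
    by (simp add: herm_cross 0 flip: herm_self)
  then have "hq (cross v w) = - (hq v * hq w)" by (simp only: of_real_eq_iff)
  then have neg: "hq (cross v w) < 0" using pos by simp
  then have "cross v w \<noteq> 0" by (auto simp: hq_def)
  \<comment> \<open>\<open>su21_cross\<close> makes \<open>x\<close> a derivation of the cross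
    product, which is conjugate linear in each factor.\<close>
  moreover have "x *v cross v w = cnj (t + s) *s cross v w"
    unfolding su21_cross [OF x] v(2) w(2)
    by (simp add: cross_def vec_eq_iff forall_3 algebra_simps)
  ultimately show ?thesis using neg by (intro exI [of _ "cross v w"] exI [of _ "cnj (t + s)"]) auto
qed

text \<open>A vector that is both in the image and in the kernel of \<open>x\<close> is null:
  skewness moves \<open>x\<close> from one argument of the form to the other.\<close>

lemma null_eigenvector_of_nilpotent:
  assumes x: "x \<in> su21" "x \<noteq> 0" "x ** x ** x = 0"
  shows "\<exists>u. u \<noteq> 0 \<and> hq u = 0 \<and> x *v u = 0"
proof -
  have nz: "\<exists>z. A *v z \<noteq> 0" if "A \<noteq> 0" for A :: cmat3
    using that by (metis matrix_eq matrix_vector_mult_0)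
  show ?thesis
  proof (cases "x ** x = 0")
    case True
    obtain z where z: "x *v z \<noteq> 0" using nz x(2) by blast
    have "x *v (x *v z) = 0" by (simp add: matrix_vector_mul_assoc True)
    moreover from this have "herm (x *v z) (x *v z) = 0"
      using herm_su21 [OF x(1), of z "x *v z"] by (simp add: herm_def)
    ultimately show ?thesis using z by (auto simp: herm_self)
  next
    case False
    obtain z where z: "x ** x *v z \<noteq> 0" using nz False by blast
    then have z': "x *v (x *v z) \<noteq> 0" by (simp add: matrix_vector_mul_assoc)
    have "x *v (x *v (x *v z)) = 0" by (simp add: matrix_vector_mul_assoc matrix_mul_assoc x(3))
    moreover from this have "herm (x *v (x *v z)) (x *v (x *v z)) = 0"
      using herm_su21 [OF x(1), of "x *v z" "x *v (x *v z)"] by (simp add: herm_def)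
    ultimately show ?thesis using z' by (auto simp: herm_self)
  qed
qed

lemma nonpositive_eigenvector:
  assumes x: "x \<in> su21" "x \<noteq> 0"
  shows "\<exists>u r. u \<noteq> 0 \<and> hq u \<le> 0 \<and> x *v u = r *s u"
proof -
  obtain a b c d e f g h k where x': "x = mk3 a b c d e f g h k" by (rule mk3_cases)
  have "trace x = 0" using x(1) by (simp add: su21_iff)
  then have k: "k = - a - e" by (simp add: x' mk3_simps) algebra
  \<comment> \<open>The sum of the principal 2 by 2 minors, the only middle coefficient left when
    the trace is zero.\<close>
  define E where "E = a * e + a * k + e * k - b * d - c * g - f * h"
  have cp: "det (x - mat t) = det x - E * t - t * t * t" for t
    unfolding x' mk3_simps E_def k by algebra
  have CH: "x ** x ** x = mat (det x) - mat E ** x"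
    unfolding x' mk3_simps E_def k by (intro conjI; algebra)
  have "\<not> constant (poly [:det x, - E, 0, - 1:])"
    by (simp add: constant_degree)
  then obtain t where t: "poly [:det x, - E, 0, - 1:] t = 0"
    using fundamental_theorem_of_algebra by blast
  then have dx: "det x = E * t + t * t * t" by (simp add: algebra_simps add_eq_0_iff)
  have ne: ?thesis if "t \<noteq> s" "s * s + t * s + t * t + E = 0" for s
  proof -
    have "det (x - mat t) = 0" unfolding cp dx by simp
    moreover have "det (x - mat s) = 0" unfolding cp dx using that(2) by algebra
    ultimately show ?thesis using nonpositive_eigenvector_of_distinct [OF x(1)] that(1)
      by (metis eigenvector_of_det_0)
  qed
  \<comment> \<open>A second root of the characteristic polynomial, from the quadratic left after
    splitting off the root \<open>t\<close>.\<close>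
  define s where "s = (- t + csqrt (- 3 * t * t - 4 * E)) / 2"
  have "2 * s + t = csqrt (- 3 * t * t - 4 * E)"
    by (simp add: s_def field_simps)
  then have "(2 * s + t) * (2 * s + t) = - 3 * t * t - 4 * E"
    by (simp flip: power2_eq_square)
  then have s: "s * s + t * s + t * t + E = 0" by algebra
  show ?thesis
  proof (cases "t = s \<and> t = 0")
    case False
    then consider "t \<noteq> s" | "t = s" "t \<noteq> 0" by auto
    then show ?thesis
    proof cases
      case 1
      then show ?thesis using ne s by blast
    next
      case 2
      \<comment> \<open>The roots sum to zero, so a double root \<open>t\<close> leaves
        \<open>- 2 * t\<close> as the third one.\<close>
      have "t \<noteq> - 2 * t" using 2 by (simp add: eq_neg_iff_add_eq_0)
      moreover have "(- 2 * t) * (- 2 * t) + t * (- 2 * t) + t * t + E = 0" using s 2(1) by algebra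
      ultimately show ?thesis using ne by blast
    qed
  next
    case True
    then have "E = 0" "det x = 0" using s dx by auto
    \<comment> \<open>With zero as the only eigenvalue, Cayley-Hamilton reduces to
      nilpotency.\<close>
    then have "x ** x ** x = 0" using CH by (simp add: mk3_simps mk3_0 x')
    then show ?thesis using null_eigenvector_of_nilpotent [OF x] by (metis order_refl vector_smult_lzero)
  qed
qed

lemma conj_to_list:
  assumes "x \<in> su21" "x \<noteq> 0"
  shows "\<exists>p\<in>labels. span {x} \<sim>\<^sub>S\<^sub>U subalg p"
proof -
  obtain u r where u: "u \<noteq> 0" "hq u \<le> 0" "x *v u = r *s u"
    using nonpositive_eigenvector [OF assms] by blast
  show ?thesis
  proof (cases "hq u = 0")
    case True
    then show ?thesis using conj_of_null_eigenvector assms u by blast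
  next
    case False
    then obtain \<mu> where "span {x} \<sim>\<^sub>S\<^sub>U subalg (V15 \<mu>)"
      using conj_of_negative_eigenvector [of x u r] assms u by auto
    then show ?thesis by (auto simp: labels_def simp del: subalg.simps)
  qed
qed

section \<open>Conjugacy invariants\<close>

lemma frame_self: "frame x N21 x"
  by (rule frameI [of "mat 1"]) (simp, simp add: mk3_simps, simp)

lemma conj_sym:
  assumes "span {x} \<sim>\<^sub>S\<^sub>U span {y}" "y \<noteq> 0"
  shows "span {y} \<sim>\<^sub>S\<^sub>U span {x}"
proof -
  obtain g c where g: "det g = 1" "ctranspose g ** N21 ** g = N21" "c \<noteq> 0" "c *\<^sub>R (g ** x) = y ** g"
    using conj_imp [OF assms] .
  have "y ** g = g ** (c *\<^sub>R x)" by (simp add: g(4) [symmetric] matrix_scalar_ac scalar_matrix_assoc)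
  then have "frame y N21 (c *\<^sub>R x)" using g by (intro frameI [of g]) auto
  moreover have "frame x N21 ((1 / c) *\<^sub>R (c *\<^sub>R x))" using frame_self g(3) by simp
  ultimately show ?thesis by (rule frame_conj) (use g(3) in simp)
qed

definition has_negative_eigenvector :: "cmat3 \<Rightarrow> bool" where
  "has_negative_eigenvector x \<longleftrightarrow> (\<exists>v t. hq v < 0 \<and> x *v v = t *s v)"

lemma herm_isometry:
  assumes "ctranspose g ** N21 ** g = N21"
  shows "herm (g *v u) (g *v v) = herm u v"
proof -
  obtain a b c d e f p q r where g: "g = mk3 a b c d e f p q r" by (rule mk3_cases)
  obtain u1 u2 u3 where u: "u = vector [u1, u2, u3]" by (rule vec3_cases)
  obtain v1 v2 v3 where v: "v = vector [v1, v2, v3]" by (rule vec3_cases)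
  have "herm (g *v u) (g *v v) =
    (\<Sum>i\<in>UNIV. \<Sum>j\<in>UNIV. cnj (v $ i) * u $ j * (ctranspose g ** N21 ** g) $ i $ j)"
    unfolding g u v by (simp add: mk3_simps sum_3 herm_def algebra_simps)
  also have "\<dots> = herm u v"
    unfolding assms by (simp add: N21_eq sum_3 herm_def u v algebra_simps)
  finally show ?thesis .
qed

text \<open>Everything follows from \<open>y = c *\<^sub>R (g ** x ** h)\<close>, with
  \<open>h\<close> inverse to the isometry \<open>g\<close>. The unknown factor \<open>c\<close> is
  why only scale-free combinations are invariants of the line.\<close>

lemma conj_transport:
  assumes "span {x} \<sim>\<^sub>S\<^sub>U span {y}" "y \<noteq> 0"
  obtains g and c :: real where "c \<noteq> 0"
    "\<And>v. y *v (g *v v) = of_real c *s (g *v (x *v v))"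
    "\<And>u v. herm (g *v u) (g *v v) = herm u v"
    "trace (y ** y) = of_real (c ^ 2) * trace (x ** x)"
    "det y = of_real (c ^ 3) * det x"
    "y ** y = 0 \<longleftrightarrow> x ** x = 0"
proof -
  obtain g c where g: "det g = 1" "ctranspose g ** N21 ** g = N21" "c \<noteq> 0" "c *\<^sub>R (g ** x) = y ** g"
    using conj_imp [OF assms] .
  define h where "h = matrix_inv g"
  have i: "g ** h = mat 1" "h ** g = mat 1" using matrix_inv_mult [of g] g(1) by (simp_all add: h_def)
  have smult: "(c *\<^sub>R A) *v v = of_real c *s (A *v v)" for A :: cmat3 and v
    by (cases A rule: mk3_cases; cases v rule: vec3_cases) (simp add: mk3_simps algebra_simps)
  have "y *v (g *v v) = of_real c *s (g *v (x *v v))" for v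
    by (simp add: matrix_vector_mul_assoc smult flip: g(4))
  moreover have y: "y = c *\<^sub>R (g ** x ** h)"
  proof -
    have "y = y ** g ** h" by (simp add: i flip: matrix_mul_assoc)
    also have "\<dots> = c *\<^sub>R (g ** x ** h)" by (simp add: scalar_matrix_assoc flip: g(4))
    finally show ?thesis .
  qed
  have yy: "y ** y = (c ^ 2) *\<^sub>R (g ** (x ** x) ** h)"
  proof -
    have "y ** y = (c ^ 2) *\<^sub>R ((g ** x ** h) ** (g ** x ** h))"
      by (simp add: y matrix_scalar_ac power2_eq_square flip: scalar_matrix_assoc)
    also have "(g ** x ** h) ** (g ** x ** h) = g ** x ** (h ** g) ** x ** h"
      by (simp add: matrix_mul_assoc)
    finally show ?thesis by (simp add: i matrix_mul_assoc)
  qed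
  have tr: "trace (k *\<^sub>R A) = of_real k * trace A" for k and A :: cmat3
    by (cases A rule: mk3_cases) (simp add: mk3_simps algebra_simps)
  have "trace (g ** (x ** x) ** h) = trace (x ** x)"
    by (subst trace_mul_sym) (simp add: matrix_mul_assoc i)
  then have "trace (y ** y) = of_real (c ^ 2) * trace (x ** x)" by (simp add: yy tr)
  moreover have "det y = of_real (c ^ 3) * det x"
  proof -
    have "det (c *\<^sub>R A) = of_real (c ^ 3) * det A" for A :: cmat3
      by (cases A rule: mk3_cases) (simp add: mk3_simps algebra_simps power3_eq_cube)
    moreover have "det g * det h = 1" by (metis i(1) det_I det_mul)
    ultimately show ?thesis by (simp add: y det_mul g(1))
  qed
  moreover have "y ** y = 0 \<longleftrightarrow> x ** x = 0"
  proof
    assume "y ** y = 0"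
    then have "g ** (x ** x) ** h = 0" using g(3) by (simp add: yy)
    then have "h ** (g ** (x ** x) ** h) ** g = 0" by simp
    then have "(h ** g) ** (x ** x) ** (h ** g) = 0" by (simp add: matrix_mul_assoc)
    then show "x ** x = 0" by (simp add: i)
  qed (simp add: yy)
  ultimately show ?thesis using that g(3) herm_isometry [OF g(2)] by blast
qed

section \<open>Generators of the lines and values of their invariants\<close>

fun gen :: "label \<Rightarrow> cmat3" where
  "gen V11 = - A1 - 2 *\<^sub>R A2 - A4 + sqrt 2 *\<^sub>R A6 + sqrt 2 *\<^sub>R A8"
| "gen V12 = A3 + A4 + A7 - A8"
| "gen V13 = 3 *\<^sub>R A1 + 6 *\<^sub>R A2 - 5 *\<^sub>R A4 - sqrt 2 *\<^sub>R A6 - sqrt 2 *\<^sub>R A8"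
| "gen V14 = A1 + 2 *\<^sub>R A2 + 7 *\<^sub>R A4 - sqrt 2 *\<^sub>R A6 + sqrt 2 *\<^sub>R A8"
| "gen (V15 \<mu>) = A1 + \<mu> *\<^sub>R A2"
| "gen V16 = A5 - A7"
| "gen (V17 \<mu>) = A1 - A2 + \<mu> *\<^sub>R A5"

lemma subalg_eq_span_gen: "subalg p = span {gen p}"
  by (cases p) simp_all

lemma gen_eqs:
  "gen V11 = mk3 (- \<i>) (- \<i>) (\<i> * sqrt 2) (- \<i>) (- \<i>) (\<i> * sqrt 2) (- \<i> * sqrt 2) (- \<i> * sqrt 2) (2 * \<i>)"
  "gen V12 = mk3 0 (1 + \<i>) 0 (\<i> - 1) 0 (1 - \<i>) 0 (1 + \<i>) 0"
  "gen V13 = mk3 (3 * \<i>) (- 5 * \<i>) (- \<i> * sqrt 2) (- 5 * \<i>) (3 * \<i>) (- \<i> * sqrt 2) (\<i> * sqrt 2) (\<i> * sqrt 2) (- 6 * \<i>)"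
  "gen V14 = mk3 \<i> (7 * \<i>) (- \<i> * sqrt 2) (7 * \<i>) \<i> (\<i> * sqrt 2) (\<i> * sqrt 2) (- \<i> * sqrt 2) (- 2 * \<i>)"
  "gen (V15 \<mu>) = mk3 \<i> 0 0 0 (\<i> * (complex_of_real \<mu> - 1)) 0 0 0 (- \<i> * \<mu>)"
  "gen V16 = mk3 0 0 1 0 0 (- 1) 1 (- 1) 0"
  "gen (V17 \<mu>) = mk3 \<i> 0 \<mu> 0 (- 2 * \<i>) 0 \<mu> 0 \<i>"
  by (simp_all add: A_eqs mk3_simps algebra_simps)

lemma gen_in_su21: "gen p \<in> su21"
  by (cases p) (simp_all add: su21_iff gen_eqs mk3_simps mk3_0 algebra_simps del: gen.simps)

lemma gen_nonzero: "gen p \<noteq> 0"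
  by (cases p) (simp_all add: gen_eqs mk3_simps mk3_0 complex_eq_iff del: gen.simps)

text \<open>Each condition is homogeneous in the generator. The last one says that the discriminant
  of the characteristic polynomial vanishes: both sides scale by the sixth power, and for trace zero
  their difference is twice the discriminant.\<close>

lemma conj_invariants:
  assumes "subalg p \<sim>\<^sub>S\<^sub>U subalg q"
  shows "has_negative_eigenvector (gen p) \<longleftrightarrow> has_negative_eigenvector (gen q)"
    "gen p ** gen p = 0 \<longleftrightarrow> gen q ** gen q = 0"
    "trace (gen p ** gen p) = 0 \<longleftrightarrow> trace (gen q ** gen q) = 0"
    "det (gen p) = 0 \<longleftrightarrow> det (gen q) = 0"
    "trace (gen p ** gen p) ^ 3 = 54 * det (gen p) ^ 2 \<longleftrightarrow> trace (gen q ** gen q) ^ 3 = 54 * det (gen q) ^ 2"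
proof -
  have c: "span {gen p} \<sim>\<^sub>S\<^sub>U span {gen q}" using assms by (simp add: subalg_eq_span_gen)
  have *: "has_negative_eigenvector y"
    if c: "span {x} \<sim>\<^sub>S\<^sub>U span {y}" "y \<noteq> 0" and neg: "has_negative_eigenvector x" for x y
  proof -
    obtain v t where v: "hq v < 0" "x *v v = t *s v"
      using neg by (auto simp: has_negative_eigenvector_def)
    from conj_transport [OF c] obtain g and r :: real where
      g: "\<And>v. y *v (g *v v) = of_real r *s (g *v (x *v v))"
         "\<And>u v. herm (g *v u) (g *v v) = herm u v" by metis
    have "complex_of_real (hq (g *v v)) = of_real (hq v)"
      using g(2) [of v v] by (simp only: herm_self)
    then have "hq (g *v v) < 0" using v(1) by (simp only: of_real_eq_iff)
    moreover have "y *v (g *v v) = (of_real r * t) *s (g *v v)"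
      by (simp add: g(1) v(2) vector_scalar_commute vector_smult_assoc)
    ultimately show ?thesis by (auto simp: has_negative_eigenvector_def)
  qed
  show "has_negative_eigenvector (gen p) \<longleftrightarrow> has_negative_eigenvector (gen q)"
    using * c conj_sym gen_nonzero by metis
  obtain r :: real where r: "r \<noteq> 0"
    "trace (gen q ** gen q) = of_real (r ^ 2) * trace (gen p ** gen p)"
    "det (gen q) = of_real (r ^ 3) * det (gen p)"
    "gen q ** gen q = 0 \<longleftrightarrow> gen p ** gen p = 0"
    using conj_transport [OF c gen_nonzero] by metis
  show "gen p ** gen p = 0 \<longleftrightarrow> gen q ** gen q = 0" using r by simp
  show "trace (gen p ** gen p) = 0 \<longleftrightarrow> trace (gen q ** gen q) = 0" using r by simp
  show "det (gen p) = 0 \<longleftrightarrow> det (gen q) = 0" using r by simp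
  have "trace (gen q ** gen q) ^ 3 - 54 * det (gen q) ^ 2 =
    of_real (r ^ 6) * (trace (gen p ** gen p) ^ 3 - 54 * det (gen p) ^ 2)"
    unfolding r of_real_power by algebra
  moreover have "complex_of_real (r ^ 6) \<noteq> 0" using r(1) by simp
  ultimately show "trace (gen p ** gen p) ^ 3 = 54 * det (gen p) ^ 2 \<longleftrightarrow> trace (gen q ** gen q) ^ 3 = 54 * det (gen q) ^ 2"
    by (metis mult_eq_0_iff right_minus_eq)
qed

lemma invariants_V11:
  "gen V11 ** gen V11 = 0" "trace (gen V11 ** gen V11) = 0" "det (gen V11) = 0"
  unfolding gen_eqs mk3_0 by (simp_all add: mk3_simps algebra_simps complex_eq_iff)

lemma invariants_V12:
  "gen V12 ** gen V12 \<noteq> 0" "trace (gen V12 ** gen V12) = 0" "det (gen V12) = 0"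
  unfolding gen_eqs mk3_0 by (simp_all add: mk3_simps algebra_simps complex_eq_iff)

lemma invariants_V13:
  "gen V13 ** gen V13 \<noteq> 0" "trace (gen V13 ** gen V13) = - 96" "det (gen V13) = - 128 * \<i>"
  unfolding gen_eqs mk3_0 by (simp_all add: mk3_simps algebra_simps complex_eq_iff)

lemma invariants_V14:
  "gen V14 ** gen V14 \<noteq> 0" "trace (gen V14 ** gen V14) = - 96" "det (gen V14) = - 128 * \<i>"
  unfolding gen_eqs mk3_0 by (simp_all add: mk3_simps algebra_simps complex_eq_iff)

lemma invariants_V15:
  "trace (gen (V15 \<mu>) ** gen (V15 \<mu>)) = of_real (- 1 - (\<mu> - 1)\<^sup>2 - \<mu>\<^sup>2)"
  unfolding gen_eqs by (simp add: mk3_simps algebra_simps complex_eq_iff power2_eq_square)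

lemma invariants_V16:
  "trace (gen V16 ** gen V16) = 4" "det (gen V16) = 0"
  unfolding gen_eqs mk3_0 by (simp_all add: mk3_simps)

lemma invariants_V17:
  "trace (gen (V17 \<mu>) ** gen (V17 \<mu>)) = of_real (2 * \<mu>\<^sup>2 - 6)" "det (gen (V17 \<mu>)) = 2 * \<i> * of_real (1 + \<mu>\<^sup>2)"
  unfolding gen_eqs by (simp_all add: mk3_simps algebra_simps complex_eq_iff power2_eq_square)

lemma discriminant_V17:
  assumes "\<mu> \<noteq> 0"
  shows "trace (gen (V17 \<mu>) ** gen (V17 \<mu>)) ^ 3 \<noteq> 54 * det (gen (V17 \<mu>)) ^ 2"
proof
  assume eq: "trace (gen (V17 \<mu>) ** gen (V17 \<mu>)) ^ 3 = 54 * det (gen (V17 \<mu>)) ^ 2"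
  have "54 * det (gen (V17 \<mu>)) ^ 2 = of_real (- 216 * (1 + \<mu>\<^sup>2)\<^sup>2)"
    by (simp add: invariants_V17 power_mult_distrib del: gen.simps)
  then have "complex_of_real ((2 * \<mu>\<^sup>2 - 6) ^ 3) = of_real (- 216 * (1 + \<mu>\<^sup>2)\<^sup>2)"
    using eq by (simp only: invariants_V17 of_real_power)
  then have "(2 * \<mu>\<^sup>2 - 6) ^ 3 = - 216 * (1 + \<mu>\<^sup>2)\<^sup>2" by (simp only: of_real_eq_iff)
  \<comment> \<open>Eight times this product is the difference of the two sides.\<close>
  then have "\<mu>\<^sup>2 * (\<mu>\<^sup>2 + 9)\<^sup>2 = 0" by algebra
  moreover have "\<mu>\<^sup>2 + 9 > 0" by (simp add: add_nonneg_pos)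
  ultimately show False using assms by simp
qed

section \<open>Negative eigenvectors of the generators\<close>

lemma V15_negative_eigenvector: "has_negative_eigenvector (gen (V15 \<mu>))"
proof -
  have "gen (V15 \<mu>) *v vector [0, 0, 1] = (- \<i> * \<mu>) *s vector [0, 0, 1]"
    by (simp add: gen_eqs mk3_simps del: gen.simps)
  moreover have "hq (vector [0, 0, 1]) < 0" by (simp add: hq_def)
  ultimately show ?thesis unfolding has_negative_eigenvector_def by blast
qed

lemma not_has_negative_eigenvectorI:
  assumes "\<And>a b c t. x *v vector [a, b, c] = t *s vector [a, b, c] \<Longrightarrow>
    (cmod c)\<^sup>2 \<le> (cmod a)\<^sup>2 + (cmod b)\<^sup>2"
  shows "\<not> has_negative_eigenvector x"
proof -
  have "hq v \<ge> 0" if eq: "x *v v = t *s v" for v t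
  proof -
    obtain a b c where v: "v = vector [a, b, c]" by (rule vec3_cases)
    show ?thesis using assms [OF eq [unfolded v]] by (simp add: v hq_def)
  qed
  then show ?thesis unfolding has_negative_eigenvector_def by (meson not_le)
qed

lemma sqrt2_square: "complex_of_real (sqrt 2) * complex_of_real (sqrt 2) = 2"
  by (simp flip: of_real_mult)

lemma norm_sqrt2_mult: "(cmod (complex_of_real (sqrt 2) * a))\<^sup>2 = 2 * (cmod a)\<^sup>2"
  by (simp add: norm_mult power_mult_distrib)

lemma V11_no_negative_eigenvector: "\<not> has_negative_eigenvector (gen V11)"
proof (rule not_has_negative_eigenvectorI)
  fix a b c t assume eq: "gen V11 *v vector [a, b, c] = t *s vector [a, b, c]"
  define r where "r = complex_of_real (sqrt 2)"
  note r = sqrt2_square [folded r_def]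
  have i: "\<i> * \<i> = - 1" by simp
  have eqs: "- \<i> * a + - \<i> * b + \<i> * r * c = t * a" "- \<i> * a + - \<i> * b + \<i> * r * c = t * b"
    "- \<i> * r * a + - \<i> * r * b + 2 * \<i> * c = t * c"
    using eq unfolding gen_eqs mk3_simps r_def by blast+
  show "(cmod c)\<^sup>2 \<le> (cmod a)\<^sup>2 + (cmod b)\<^sup>2"
  proof (cases "t = 0")
    case True
    then have "r * c = a + b" using eqs(1) i by algebra
    then have "2 * (cmod c)\<^sup>2 = (cmod (a + b))\<^sup>2" by (metis norm_sqrt2_mult r_def)
    \<comment> \<open>On the kernel the claim reduces to the parallelogram inequality.\<close>
    also have "\<dots> \<le> 2 * ((cmod a)\<^sup>2 + (cmod b)\<^sup>2)"
      unfolding cmod_power2 using sum_squares_ge_zero [of "Re a - Re b" "Im a - Im b"]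
      by (simp add: power2_eq_square algebra_simps)
    finally show ?thesis by simp
  next
    case False
    \<comment> \<open>\<open>gen V11\<close> squares to zero.\<close>
    have "t * t * c = 0" using eqs r i by algebra
    then show ?thesis using False by simp
  qed
qed

lemma V12_no_negative_eigenvector: "\<not> has_negative_eigenvector (gen V12)"
proof (rule not_has_negative_eigenvectorI)
  fix a b c t assume eq: "gen V12 *v vector [a, b, c] = t *s vector [a, b, c]"
  have i: "\<i> * \<i> = - 1" by simp
  have "gen V12 *v vector [a, b, c] = vector [(1 + \<i>) * b, (\<i> - 1) * a + (1 - \<i>) * c, (1 + \<i>) * b]"
    unfolding gen_eqs mk3_simps by simp
  then have eqs: "(1 + \<i>) * b = t * a" "(\<i> - 1) * a + (1 - \<i>) * c = t * b" "(1 + \<i>) * b = t * c"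
    using eq unfolding vec3_smult by (simp_all only: vec3_eq_iff)
  show "(cmod c)\<^sup>2 \<le> (cmod a)\<^sup>2 + (cmod b)\<^sup>2"
  proof (cases "t = 0")
    case True
    then have "(1 - \<i>) * (c - a) = 0" using eqs(2) by algebra
    moreover have "1 - \<i> \<noteq> 0" by (simp add: complex_eq_iff)
    ultimately show ?thesis by simp
  next
    case False
    then have "a = c" using eqs by (metis mult_left_cancel)
    then show ?thesis by simp
  qed
qed

text \<open>An eigenvector with \<open>c \<noteq> 0\<close> belongs to the double eigenvalue
  \<open>- 4 * \<i>\<close>, whose eigenspace is a null line. The same argument serves for
  \<open>V14\<close>.\<close>

lemma V13_no_negative_eigenvector: "\<not> has_negative_eigenvector (gen V13)"
proof (rule not_has_negative_eigenvectorI)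
  fix a b c t assume eq: "gen V13 *v vector [a, b, c] = t *s vector [a, b, c]"
  define r where "r = complex_of_real (sqrt 2)"
  note r = sqrt2_square [folded r_def]
  have i: "\<i> * \<i> = - 1" by simp
  have eqs: "3 * \<i> * a + - 5 * \<i> * b + - \<i> * r * c = t * a" "- 5 * \<i> * a + 3 * \<i> * b + - \<i> * r * c = t * b"
    "\<i> * r * a + \<i> * r * b + - 6 * \<i> * c = t * c"
    using eq unfolding gen_eqs mk3_simps r_def by blast+
  have "(t + 4 * \<i>) * (t + 4 * \<i>) * c = 0" using eqs r i by algebra
  then consider "c = 0" | "t = - 4 * \<i>" by (auto simp: add_eq_0_iff)
  then show "(cmod c)\<^sup>2 \<le> (cmod a)\<^sup>2 + (cmod b)\<^sup>2"
  proof cases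
    case 2
    have "12 * \<i> * (a - b) = 0" using eqs 2 by algebra
    then have "a = b" by simp
    have "\<i> * (2 * r * a - 2 * c) = 0" using eqs(3) 2 \<open>a = b\<close> by algebra
    then have "c = r * a" by simp
    then show ?thesis by (simp add: r_def norm_sqrt2_mult \<open>a = b\<close>)
  qed simp
qed

lemma V14_no_negative_eigenvector: "\<not> has_negative_eigenvector (gen V14)"
proof (rule not_has_negative_eigenvectorI)
  fix a b c t assume eq: "gen V14 *v vector [a, b, c] = t *s vector [a, b, c]"
  define r where "r = complex_of_real (sqrt 2)"
  note r = sqrt2_square [folded r_def]
  have i: "\<i> * \<i> = - 1" by simp
  have eqs: "\<i> * a + 7 * \<i> * b + - \<i> * r * c = t * a" "7 * \<i> * a + \<i> * b + \<i> * r * c = t * b"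
    "\<i> * r * a + - \<i> * r * b + - 2 * \<i> * c = t * c"
    using eq unfolding gen_eqs mk3_simps r_def by blast+
  have "(t + 4 * \<i>) * (t + 4 * \<i>) * c = 0" using eqs r i by algebra
  then consider "c = 0" | "t = - 4 * \<i>" by (auto simp: add_eq_0_iff)
  then show "(cmod c)\<^sup>2 \<le> (cmod a)\<^sup>2 + (cmod b)\<^sup>2"
  proof cases
    case 2
    have "12 * \<i> * (a + b) = 0" using eqs 2 by algebra
    then have "b = - a" by (simp add: add_eq_0_iff)
    have "\<i> * (2 * r * a + 2 * c) = 0" using eqs(3) 2 \<open>b = - a\<close> by algebra
    then have "c = - (r * a)" by (simp add: add_eq_0_iff)
    then show ?thesis by (simp add: r_def norm_sqrt2_mult \<open>b = - a\<close>)
  qed simp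
qed

lemma V16_no_negative_eigenvector: "\<not> has_negative_eigenvector (gen V16)"
proof (rule not_has_negative_eigenvectorI)
  fix a b c t assume eq: "gen V16 *v vector [a, b, c] = t *s vector [a, b, c]"
  have "gen V16 *v vector [a, b, c] = vector [c, - c, a - b]"
    unfolding gen_eqs mk3_simps by simp
  then have eqs: "c = t * a" "- c = t * b" "a - b = t * c"
    using eq unfolding vec3_smult by (simp_all only: vec3_eq_iff)
  have "c * (t * t - 2) = 0" using eqs by algebra
  then consider "c = 0" | "t * t = 2" by auto
  then show "(cmod c)\<^sup>2 \<le> (cmod a)\<^sup>2 + (cmod b)\<^sup>2"
  proof cases
    case 2
    have t2: "(cmod t)\<^sup>2 = 2" using 2 by (metis norm_mult norm_numeral power2_eq_square)
    have "(a + b) * 2 = 0" using eqs(1,2) 2 by algebra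
    then have "b = - a" by (simp add: add_eq_0_iff)
    then show ?thesis unfolding eqs(1) norm_mult power_mult_distrib t2 by simp
  qed simp
qed

text \<open>The first and third coordinates of an eigenvector agree up to sign.\<close>

lemma V17_no_negative_eigenvector:
  assumes "\<mu> \<noteq> 0"
  shows "\<not> has_negative_eigenvector (gen (V17 \<mu>))"
proof (rule not_has_negative_eigenvectorI)
  fix a b c t assume eq: "gen (V17 \<mu>) *v vector [a, b, c] = t *s vector [a, b, c]"
  have eqs: "\<i> * a + \<mu> * c = t * a" "\<mu> * a + \<i> * c = t * c"
    using eq unfolding gen_eqs mk3_simps by simp_all
  show "(cmod c)\<^sup>2 \<le> (cmod a)\<^sup>2 + (cmod b)\<^sup>2"
  proof -
    have "(complex_of_real \<mu>) * ((a - c) * (a + c)) = 0" using eqs by algebra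
    then have "a = c \<or> a = - c" using assms by (simp add: eq_neg_iff_add_eq_0)
    then show ?thesis by auto
  qed
qed

section \<open>Separation of \<open>V13\<close> from \<open>V14\<close>, and conjugacy within the
  families\<close>

text \<open>The shift by 4 comes from the double eigenvalue \<open>- 4 * \<i>\<close>. It leaves a
  semidefinite form, exhibited as a sum of squares.\<close>

lemma V13_form_nonneg: "Im (herm (gen V13 *v w) w) + 4 * hq w \<ge> 0"
proof -
  obtain a b c where w: "w = vector [a, b, c]" by (rule vec3_cases)
  have "Im (herm (gen V13 *v w) w) + 4 * hq w =
    6 * ((Re a - Re b)\<^sup>2 + (Im a - Im b)\<^sup>2)
    + (Re a + Re b - sqrt 2 * Re c)\<^sup>2 + (Im a + Im b - sqrt 2 * Im c)\<^sup>2"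
    unfolding hq_def cmod_power2
    by (simp add: gen_eqs mk3_simps w herm_def power2_eq_square algebra_simps del: gen.simps)
  then show ?thesis by simp
qed

text \<open>Equal traces of squares and equal determinants force the factor \<open>r = 1\<close>, so
  the shifted form would be transported unchanged. For \<open>V14\<close> its value at the third
  basis vector is 2 - 4 < 0.\<close>

lemma not_conj_V14_V13: "\<not> subalg V14 \<sim>\<^sub>S\<^sub>U subalg V13"
proof
  assume "subalg V14 \<sim>\<^sub>S\<^sub>U subalg V13"
  then have c: "span {gen V14} \<sim>\<^sub>S\<^sub>U span {gen V13}" by (simp only: subalg_eq_span_gen)
  obtain g and r :: real where g: "r \<noteq> 0"
    "\<And>v. gen V13 *v (g *v v) = of_real r *s (g *v (gen V14 *v v))"
    "\<And>u v. herm (g *v u) (g *v v) = herm u v"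
    "trace (gen V13 ** gen V13) = of_real (r ^ 2) * trace (gen V14 ** gen V14)"
    "det (gen V13) = of_real (r ^ 3) * det (gen V14)"
    using conj_transport [OF c gen_nonzero] by metis
  have "complex_of_real (r ^ 2) = of_real 1" "complex_of_real (r ^ 3) = of_real 1"
    using g(4,5) unfolding invariants_V13 invariants_V14 by simp_all
  then have "r ^ 2 = 1" "r ^ 3 = 1" by (simp_all only: of_real_eq_iff)
  then have r: "r = 1" by (simp add: power3_eq_cube power2_eq_square)
  define e :: "complex^3" where "e = vector [0, 0, 1]"
  have "complex_of_real (hq (g *v e)) = of_real (hq e)"
    using g(3) [of e e] by (simp only: herm_self)
  then have "hq (g *v e) = - 1" by (simp only: of_real_eq_iff) (simp add: e_def hq_def)
  moreover have "herm (gen V13 *v (g *v e)) (g *v e) = herm (gen V14 *v e) e"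
    by (simp add: g(2,3) r del: gen.simps)
  moreover have "herm (gen V14 *v e) e = 2 * \<i>"
    by (simp add: gen_eqs mk3_simps e_def herm_def del: gen.simps)
  ultimately show False using V13_form_nonneg [of "g *v e"] by simp
qed

lemma conj_refl: "span {x} \<sim>\<^sub>S\<^sub>U span {x}"
  using frame_conj [of x N21 x x 1] frame_self by simp

text \<open>The image of the negative eigenvector is negative, so its last coordinate is nonzero and
  the eigenvalues can be compared there. This gives \<open>\<eta> = r * \<mu>\<close>, and the trace
  of the square leaves two values for \<open>r\<close>.\<close>

lemma conj_V15_iff:
  "subalg (V15 \<mu>) \<sim>\<^sub>S\<^sub>U subalg (V15 \<eta>) \<longleftrightarrow> \<eta> = \<mu> \<or> (\<mu> \<noteq> 1 \<and> \<eta> = \<mu> / (\<mu> - 1))"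
proof
  assume "subalg (V15 \<mu>) \<sim>\<^sub>S\<^sub>U subalg (V15 \<eta>)"
  then have c: "span {gen (V15 \<mu>)} \<sim>\<^sub>S\<^sub>U span {gen (V15 \<eta>)}" by (simp only: subalg_eq_span_gen)
  obtain g and r :: real where g: "r \<noteq> 0"
    "\<And>v. gen (V15 \<eta>) *v (g *v v) = of_real r *s (g *v (gen (V15 \<mu>) *v v))"
    "\<And>u v. herm (g *v u) (g *v v) = herm u v"
    "trace (gen (V15 \<eta>) ** gen (V15 \<eta>)) = of_real (r ^ 2) * trace (gen (V15 \<mu>) ** gen (V15 \<mu>))"
    using conj_transport [OF c gen_nonzero] by metis
  define e :: "complex^3" where "e = vector [0, 0, 1]"
  have e: "gen (V15 \<mu>) *v e = (- \<i> * \<mu>) *s e"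
    by (simp add: gen_eqs mk3_simps e_def del: gen.simps)
  obtain a b c where w: "g *v e = vector [a, b, c]" by (rule vec3_cases)
  have "complex_of_real (hq (g *v e)) = of_real (hq e)"
    using g(3) [of e e] by (simp only: herm_self)
  then have "hq (g *v e) = - 1" by (simp only: of_real_eq_iff) (simp add: e_def hq_def)
  then have "(cmod c)\<^sup>2 = 1 + ((cmod a)\<^sup>2 + (cmod b)\<^sup>2)" by (simp add: w hq_def)
  also have "\<dots> > 0" by (simp add: add_pos_nonneg)
  finally have "c \<noteq> 0" by auto
  have "gen (V15 \<eta>) *v (g *v e) = (of_real r * (- \<i> * \<mu>)) *s (g *v e)"
    unfolding g(2) e by (simp only: vector_scalar_commute vector_smult_assoc)
  then have "- \<i> * \<eta> * c = of_real r * (- \<i> * \<mu>) * c"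
    unfolding w gen_eqs mk3_simps by simp
  then have "\<i> * (complex_of_real \<eta> - of_real (r * \<mu>)) * c = 0" by (simp add: algebra_simps)
  then have "complex_of_real \<eta> = of_real (r * \<mu>)" using \<open>c \<noteq> 0\<close> by simp
  then have eta: "\<eta> = r * \<mu>" by (simp only: of_real_eq_iff)
  have "complex_of_real (- 1 - (\<eta> - 1)\<^sup>2 - \<eta>\<^sup>2) = of_real (r\<^sup>2 * (- 1 - (\<mu> - 1)\<^sup>2 - \<mu>\<^sup>2))"
    using g(4) unfolding invariants_V15 by (simp only: of_real_mult)
  then have "- 1 - (\<eta> - 1)\<^sup>2 - \<eta>\<^sup>2 = r\<^sup>2 * (- 1 - (\<mu> - 1)\<^sup>2 - \<mu>\<^sup>2)" by (simp only: of_real_eq_iff)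
  then have "2 * ((r - 1) * (r * (\<mu> - 1) - 1)) = 0" unfolding eta by algebra
  then consider "r = 1" | "r * (\<mu> - 1) = 1" by auto
  then show "\<eta> = \<mu> \<or> (\<mu> \<noteq> 1 \<and> \<eta> = \<mu> / (\<mu> - 1))"
  proof cases
    case 2
    then have "\<mu> \<noteq> 1" by auto
    then show ?thesis using 2 by (simp add: eta field_simps)
  qed (simp add: eta)
next
  assume "\<eta> = \<mu> \<or> (\<mu> \<noteq> 1 \<and> \<eta> = \<mu> / (\<mu> - 1))"
  then consider "\<eta> = \<mu>" | "\<mu> \<noteq> 1" "\<eta> = \<mu> / (\<mu> - 1)" by auto
  then show "subalg (V15 \<mu>) \<sim>\<^sub>S\<^sub>U subalg (V15 \<eta>)"
  proof cases
    case 1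
    then show ?thesis by (simp add: conj_refl)
  next
    case 2
    have m: "complex_of_real \<mu> - 1 \<noteq> 0" using 2(1) by (metis eq_iff_diff_eq_0 of_real_eq_1_iff)
    \<comment> \<open>The second conjugacy swaps the two positive basis vectors and rescales by
      \<open>1 / (\<mu> - 1)\<close>.\<close>
    have "frame (A1 + \<mu> *\<^sub>R A2) N21 (mk3 (\<i>*(complex_of_real \<mu>-1)) 0 0 0 \<i> 0 0 0 (-\<i>*\<mu>))"
      by (rule frame_change [OF frame_V15, of "mk3 0 1 0 1 0 0 0 0 1"]) (simp_all add: mk3_simps)
    moreover have "frame (A1 + \<eta> *\<^sub>R A2) N21
      ((1/(\<mu>-1)) *\<^sub>R mk3 (\<i>*(complex_of_real \<mu>-1)) 0 0 0 \<i> 0 0 0 (-\<i>*\<mu>))"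
    proof -
      have "(1/(\<mu>-1)) *\<^sub>R mk3 (\<i>*(complex_of_real \<mu>-1)) 0 0 0 \<i> 0 0 0 (-\<i>*\<mu>) =
        mk3 \<i> 0 0 0 (\<i>*(complex_of_real \<eta>-1)) 0 0 0 (-\<i>*\<eta>)"
        using m by (simp add: mk3_simps 2(2) field_simps)
      then show ?thesis using frame_V15 [of \<eta>] by simp
    qed
    ultimately show ?thesis using frame_conj 2(1) by simp
  qed
qed

lemma conj_V17_iff:
  assumes "\<mu> \<noteq> 0" "\<eta> \<noteq> 0"
  shows "subalg (V17 \<mu>) \<sim>\<^sub>S\<^sub>U subalg (V17 \<eta>) \<longleftrightarrow> \<eta> = \<mu> \<or> \<eta> = - \<mu>"
proof
  assume "subalg (V17 \<mu>) \<sim>\<^sub>S\<^sub>U subalg (V17 \<eta>)"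
  then have c: "span {gen (V17 \<mu>)} \<sim>\<^sub>S\<^sub>U span {gen (V17 \<eta>)}" by (simp only: subalg_eq_span_gen)
  obtain r :: real where r:
    "trace (gen (V17 \<eta>) ** gen (V17 \<eta>)) = of_real (r ^ 2) * trace (gen (V17 \<mu>) ** gen (V17 \<mu>))"
    "det (gen (V17 \<eta>)) = of_real (r ^ 3) * det (gen (V17 \<mu>))"
    using conj_transport [OF c gen_nonzero] by metis
  have "complex_of_real (2 * \<eta>\<^sup>2 - 6) = of_real (r\<^sup>2 * (2 * \<mu>\<^sup>2 - 6))"
    using r(1) unfolding invariants_V17 by (simp only: of_real_mult)
  then have 1: "2 * \<eta>\<^sup>2 - 6 = r\<^sup>2 * (2 * \<mu>\<^sup>2 - 6)" by (simp only: of_real_eq_iff)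
  have "2 * \<i> * (complex_of_real (1 + \<eta>\<^sup>2) - of_real (r ^ 3 * (1 + \<mu>\<^sup>2))) = 0"
    using r(2) unfolding invariants_V17 by (simp add: algebra_simps)
  then have "complex_of_real (1 + \<eta>\<^sup>2) = of_real (r ^ 3 * (1 + \<mu>\<^sup>2))" by simp
  then have 2: "1 + \<eta>\<^sup>2 = r ^ 3 * (1 + \<mu>\<^sup>2)" by (simp only: of_real_eq_iff)
  \<comment> \<open>Eliminating \<open>\<eta>\<^sup>2\<close> from the two relations leaves a cubic
    in \<open>r\<close> divisible by \<open>r - 1\<close>. The other factor is a sum of squares that
    vanishes only if \<open>r = - 2\<close> and \<open>r * \<mu> = 0\<close>.\<close>
  have "(r - 1) * ((r * \<mu>)\<^sup>2 + (r + 2)\<^sup>2) = 0" using 1 2 by algebra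
  moreover have "r \<noteq> 0"
  proof
    assume "r = 0"
    then have "1 + \<eta>\<^sup>2 = 0" using 2 by simp
    moreover have "1 + \<eta>\<^sup>2 > 0" by (simp add: add_pos_nonneg)
    ultimately show False by simp
  qed
  then have "(r * \<mu>)\<^sup>2 + (r + 2)\<^sup>2 \<noteq> 0" using assms(1) by (simp add: sum_power2_eq_zero_iff)
  ultimately have "r = 1" by (metis mult_eq_0_iff right_minus_eq)
  then have "\<eta>\<^sup>2 = \<mu>\<^sup>2" using 1 by simp
  then show "\<eta> = \<mu> \<or> \<eta> = - \<mu>" by (simp add: power2_eq_iff)
next
  assume "\<eta> = \<mu> \<or> \<eta> = - \<mu>"
  then show "subalg (V17 \<mu>) \<sim>\<^sub>S\<^sub>U subalg (V17 \<eta>)"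
  proof
    assume "\<eta> = - \<mu>"
    \<comment> \<open>Exchanging the two null vectors of the Witt basis reverses the sign of the
      parameter.\<close>
    have "frame (A1 - A2 + \<mu> *\<^sub>R A5) W21 (mk3 (complex_of_real \<eta>+\<i>) 0 0 0 (-2*\<i>) 0 0 0 (-complex_of_real \<eta>+\<i>))"
      by (rule frame_change [OF frame_V17, of W21]) (simp_all add: mk3_simps W21_def \<open>\<eta> = - \<mu>\<close>)
    then show ?thesis using frame_conj [of _ _ _ "A1 - A2 + \<eta> *\<^sub>R A5" 1] frame_V17 by simp
  qed (simp add: conj_refl)
qed

lemma V16_square: "gen V16 ** gen V16 \<noteq> 0"
  unfolding gen_eqs mk3_0 by (simp add: mk3_simps)

text \<open>A negative eigenvector singles out \<open>V15\<close>. Among the rest, zero determinant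
  leaves \<open>V11\<close>, \<open>V12\<close> and \<open>V16\<close>, told apart by the trace of
  the square and the square itself; otherwise a nonzero discriminant singles out \<open>V17\<close>,
  and \<open>V13\<close> and \<open>V14\<close> remain.\<close>

lemma conj_labels_eq_or_family:
  assumes pq: "p \<in> labels" "q \<in> labels" "subalg p \<sim>\<^sub>S\<^sub>U subalg q"
  shows "p = q \<or> (\<exists>\<mu> \<eta>. p = V15 \<mu> \<and> q = V15 \<eta>) \<or> (\<exists>\<mu> \<eta>. p = V17 \<mu> \<and> q = V17 \<eta>)"
proof -
  have nz: "\<mu> \<noteq> 0" if "V17 \<mu> \<in> labels" for \<mu> using that by (auto simp: labels_def)
  have d17: "det (gen (V17 \<mu>)) \<noteq> 0" for \<mu>
  proof -
    have "1 + \<mu>\<^sup>2 > 0" by (simp add: add_pos_nonneg)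
    then show ?thesis unfolding invariants_V17 by (simp del: of_real_add)
  qed
  have disc: "trace (gen V13 ** gen V13) ^ 3 = 54 * det (gen V13) ^ 2"
    "trace (gen V14 ** gen V14) ^ 3 = 54 * det (gen V14) ^ 2"
    unfolding invariants_V13 invariants_V14 by (simp_all add: power_mult_distrib)
  have "\<not> subalg V13 \<sim>\<^sub>S\<^sub>U subalg V14"
    using not_conj_V14_V13 conj_sym gen_nonzero unfolding subalg_eq_span_gen by blast
  then show ?thesis
    using pq conj_invariants [OF pq(3)] not_conj_V14_V13
    by (cases p; cases q)
      (simp_all del: gen.simps subalg.simps add: V11_no_negative_eigenvector V12_no_negative_eigenvector
        V13_no_negative_eigenvector V14_no_negative_eigenvector V15_negative_eigenvector
        V16_no_negative_eigenvector V17_no_negative_eigenvector nz d17 disc discriminant_V17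
        invariants_V11 invariants_V12 invariants_V13(1) invariants_V14(1) invariants_V16 V16_square
        invariants_V13(2,3) invariants_V14(2,3))
qed

section \<open>One-dimensional subalgebras as lines, and assembly of the classification\<close>

lemma lie_subalgebra_subalg: "lie_subalgebra_su21 (subalg p) \<and> dim (subalg p) = 1"
proof
  have "k *\<^sub>R x \<in> su21" if x_in: "x \<in> su21" for k x
  proof -
    obtain A B :: real and a b c where
      x: "x = mk3 (\<i> * A) a b (- cnj a) (\<i> * B) c (cnj b) (cnj c) (- (\<i> * A) - \<i> * B)"
      using su21_cases [OF x_in] .
    show ?thesis unfolding su21_iff x by (simp add: mk3_simps mk3_0 algebra_simps)
  qed
  then have "subalg p \<subseteq> su21"
    unfolding subalg_eq_span_gen span_singleton using gen_in_su21 by auto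
  moreover have "lie_bracket x y \<in> subalg p" if xy: "x \<in> subalg p" "y \<in> subalg p" for x y
  proof -
    obtain k l where "x = k *\<^sub>R gen p" "y = l *\<^sub>R gen p"
      using xy unfolding subalg_eq_span_gen span_singleton by auto
    then have "lie_bracket x y = 0"
      by (simp add: lie_bracket_def matrix_scalar_ac mult.commute flip: scalar_matrix_assoc)
    then show ?thesis by (simp add: subalg_eq_span_gen span_zero)
  qed
  ultimately show "lie_subalgebra_su21 (subalg p)"
    unfolding lie_subalgebra_su21_def by (auto simp: subalg_eq_span_gen)
  have "independent {gen p}" using gen_nonzero by simp
  from dim_span_eq_card_independent [OF this] show "dim (subalg p) = 1"
    by (simp add: subalg_eq_span_gen)
qed

lemma one_dimensional_cases:
  assumes "subspace V" "dim V = 1"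
  obtains x where "x \<noteq> 0" "V = span {x}"
proof -
  obtain B where B: "B \<subseteq> V" "independent B" "V \<subseteq> span B" "card B = dim V"
    using basis_exists by blast
  then obtain x where x: "B = {x}" using assms(2) by (auto simp: card_1_singleton_iff)
  then have "span B \<subseteq> V" using B(1) assms(1) by (simp add: span_minimal)
  then have "V = span {x}" using B(3) x by auto
  moreover have "x \<noteq> 0" using B(2) x dependent_zero by auto
  ultimately show ?thesis using that by blast
qed

theorem theorem6p2:
  shows
    "(\<forall>p\<in>labels. lie_subalgebra_su21 (subalg p) \<and> dim (subalg p) = 1)
   \<and> (\<forall>\<uu>. lie_subalgebra_su21 \<uu> \<and> dim \<uu> = 1 \<longrightarrow> (\<exists>p\<in>labels. \<uu> \<sim>\<^sub>S\<^sub>U subalg p))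
   \<and> (\<forall>p\<in>labels. \<forall>q\<in>labels. p \<noteq> q \<and> subalg p \<sim>\<^sub>S\<^sub>U subalg q \<longrightarrow>
        (\<exists>\<mu> \<eta>. p = V15 \<mu> \<and> q = V15 \<eta>) \<or> (\<exists>\<mu> \<eta>. p = V17 \<mu> \<and> q = V17 \<eta>))
   \<and> (\<forall>\<mu> \<eta> :: real. subalg (V15 \<mu>) \<sim>\<^sub>S\<^sub>U subalg (V15 \<eta>) \<longleftrightarrow>
        \<eta> = \<mu> \<or> (\<mu> \<noteq> 1 \<and> \<eta> = \<mu> / (\<mu> - 1)))
   \<and> (\<forall>\<mu>\<in>{0..2}. \<forall>\<eta>\<in>{0..2}. \<mu> \<noteq> \<eta> \<longrightarrow> \<not> subalg (V15 \<mu>) \<sim>\<^sub>S\<^sub>U subalg (V15 \<eta>))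
   \<and> (\<forall>\<mu> :: real. \<exists>\<eta>\<in>{0..2}. subalg (V15 \<mu>) \<sim>\<^sub>S\<^sub>U subalg (V15 \<eta>))
   \<and> (\<forall>\<mu> \<eta> :: real. \<mu> \<noteq> 0 \<and> \<eta> \<noteq> 0 \<longrightarrow>
        (subalg (V17 \<mu>) \<sim>\<^sub>S\<^sub>U subalg (V17 \<eta>) \<longleftrightarrow> \<eta> = \<mu> \<or> \<eta> = - \<mu>))
   \<and> (\<forall>\<mu>\<in>{0<..}. \<forall>\<eta>\<in>{0<..}. \<mu> \<noteq> \<eta> \<longrightarrow> \<not> subalg (V17 \<mu>) \<sim>\<^sub>S\<^sub>U subalg (V17 \<eta>))
   \<and> (\<forall>\<mu> :: real. \<mu> \<noteq> 0 \<longrightarrow> (\<exists>\<eta>\<in>{0<..}. subalg (V17 \<mu>) \<sim>\<^sub>S\<^sub>U subalg (V17 \<eta>)))"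
proof (intro conjI ballI allI impI; (elim conjE)?)
  fix p assume "p \<in> labels"
  show "lie_subalgebra_su21 (subalg p)" "dim (subalg p) = 1"
    using lie_subalgebra_subalg by auto
next
  fix \<uu> assume u: "lie_subalgebra_su21 \<uu>" "dim \<uu> = 1"
  then have "subspace \<uu>" "\<uu> \<subseteq> su21" by (auto simp: lie_subalgebra_su21_def)
  with u(2) obtain x where x: "x \<noteq> 0" "\<uu> = span {x}" using one_dimensional_cases by blast
  then have "x \<in> su21" using \<open>\<uu> \<subseteq> su21\<close> span_base by blast
  then show "\<exists>p\<in>labels. \<uu> \<sim>\<^sub>S\<^sub>U subalg p" using conj_to_list x by blast
next
  fix p q assume "p \<in> labels" "q \<in> labels" "p \<noteq> q" "subalg p \<sim>\<^sub>S\<^sub>U subalg q"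
  then show "(\<exists>\<mu> \<eta>. p = V15 \<mu> \<and> q = V15 \<eta>) \<or> (\<exists>\<mu> \<eta>. p = V17 \<mu> \<and> q = V17 \<eta>)"
    using conj_labels_eq_or_family by blast
next
  fix \<mu> \<eta> :: real
  show "subalg (V15 \<mu>) \<sim>\<^sub>S\<^sub>U subalg (V15 \<eta>) \<longleftrightarrow> \<eta> = \<mu> \<or> (\<mu> \<noteq> 1 \<and> \<eta> = \<mu> / (\<mu> - 1))"
    by (rule conj_V15_iff)
next
  fix \<mu> \<eta> :: real assume range: "\<mu> \<in> {0..2}" "\<eta> \<in> {0..2}" and "\<mu> \<noteq> \<eta>"
  show "\<not> subalg (V15 \<mu>) \<sim>\<^sub>S\<^sub>U subalg (V15 \<eta>)"
  proof
    assume "subalg (V15 \<mu>) \<sim>\<^sub>S\<^sub>U subalg (V15 \<eta>)"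
    \<comment> \<open>The map from \<open>\<mu>\<close> to \<open>\<mu> / (\<mu> - 1)\<close>
      preserves the interval only at its fixed points 0 and 2: below 1 the signs clash, above 1 the
      bound \<open>\<eta> \<le> 2\<close> forces \<open>\<mu> = 2\<close>.\<close>
    then have m: "\<mu> \<noteq> 1" "\<eta> * (\<mu> - 1) = \<mu>" using \<open>\<mu> \<noteq> \<eta>\<close> by (auto simp: conj_V15_iff simp del: subalg.simps)
    show False
    proof (cases "\<mu> < 1")
      case True
      then have "\<eta> * (\<mu> - 1) \<le> 0" using range by (simp add: mult_nonneg_nonpos)
      then have "\<mu> = 0" using m(2) range by simp
      then show False using m(2) \<open>\<mu> \<noteq> \<eta>\<close> by simp
    next
      case False
      then have "\<eta> * (\<mu> - 1) \<le> 2 * (\<mu> - 1)" using range by (intro mult_right_mono) auto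
      then have "\<mu> = 2" using m(2) range by simp
      then show False using m(2) \<open>\<mu> \<noteq> \<eta>\<close> by simp
    qed
  qed
next
  fix \<mu> :: real
  show "\<exists>\<eta>\<in>{0..2}. subalg (V15 \<mu>) \<sim>\<^sub>S\<^sub>U subalg (V15 \<eta>)"
  proof (cases "\<mu> \<in> {0..2}")
    case True
    then show ?thesis unfolding conj_V15_iff by blast
  next
    case False
    then have "\<mu> < 0 \<or> \<mu> > 2" by auto
    \<comment> \<open>The same involution sends negative parameters into (0, 1) and those above 2
      into (1, 2).\<close>
    then have "\<mu> \<noteq> 1" "\<mu> / (\<mu> - 1) \<in> {0..2}" by (auto simp: field_simps)
    then show ?thesis unfolding conj_V15_iff by blast
  qed
next
  fix \<mu> \<eta> :: real assume "\<mu> \<noteq> 0" "\<eta> \<noteq> 0"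
  then show "subalg (V17 \<mu>) \<sim>\<^sub>S\<^sub>U subalg (V17 \<eta>) \<longleftrightarrow> \<eta> = \<mu> \<or> \<eta> = - \<mu>"
    by (rule conj_V17_iff)
next
  fix \<mu> \<eta> :: real assume "\<mu> \<in> {0<..}" "\<eta> \<in> {0<..}" "\<mu> \<noteq> \<eta>"
  then show "\<not> subalg (V17 \<mu>) \<sim>\<^sub>S\<^sub>U subalg (V17 \<eta>)" by (subst conj_V17_iff) auto
next
  fix \<mu> :: real assume "\<mu> \<noteq> 0"
  then show "\<exists>\<eta>\<in>{0<..}. subalg (V17 \<mu>) \<sim>\<^sub>S\<^sub>U subalg (V17 \<eta>)"
    by (intro bexI [of _ "\<bar>\<mu>\<bar>"]) (auto simp: conj_V17_iff simp del: subalg.simps)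
qed

end
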